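(* Let $C\in\mathcal C^2$, let $(U_1,V_1),(U_2,V_2),\dots$ be i.i.d. with distribution function $C$, let $E_n$ be the empirical copula of $(U_1,V_1),\dots,(U_n,V_n)$, fix $s\in(0,\tfrac12)$ and set $N(n)=\lfloor n^s\rfloor$. Then there is an at most countable set $T\subset(0,1)$ such that for every $\tau\in(0,1)\setminus T$, with probability one, $$\lim_{n\to\infty}Q^\tau_{\mathfrak{Cb}_{N(n)}(E_n)}(x)=Q^\tau_C(x)\quad\text{for }\lambda\text{-almost every }x\in\mathbb I,$$ and consequently $\lim_{n\to\infty}\|Q^\tau_{\mathfrak{Cb}_{N(n)}(E_n)}-Q^\tau_C\|_p=0$ for every $p\in[1,\infty)$, where $\|f\|_p=(\int_{\mathbb I}|f|^p\,\mathrm d\lambda)^{1/p}$.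
   Context: $\mathbb I=[0,1]$, $\lambda$ Lebesgue measure. A bivariate copula $C\in\mathcal C^2$ is the distribution function on $\mathbb I^2$ of a probability measure $\mu_C$ with uniform marginals. $K_C(x,\cdot)$ is the Markov kernel (conditional distribution of the second coordinate given the first), $\mu_C(B\times F)=\int_B K_C(x,F)\,\mathrm d\lambda(x)$, and $Q^\tau_C(x)=\inf\{y\in\mathbb I:K_C(x,[0,y])\ge\tau\}$. The empirical copula $E_n$ is the bilinear interpolation of the empirical subcopula induced by the (pseudo-)ranks of the sample. For $N\in\mathbb N$ and $D\in\mathcal C^2$, the checkerboard approximation $\mathfrak{Cb}_N(D)$ is the copula with density $N^2\sum_{i,j=1}^N\mu_D(I_{N,i}\times I_{N,j})\mathbf 1_{I_{N,i}\times I_{N,j}}$, where $I_{N,i}=(\frac{i-1}N,\frac iN)$. *)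

theory Defs
  imports "HOL-Probability.Probability"
begin

text \<open>A bivariate copula is identified with its doubly stochastic measure mu_C:
  a probability measure on the Borel sets of R x R, concentrated on the unit square,
  with uniform marginals.\<close>

definition is_copula_measure :: "(real \<times> real) measure \<Rightarrow> bool" where
  "is_copula_measure \<mu> \<longleftrightarrow>
     prob_space \<mu> \<and> sets \<mu> = sets borel \<and>
     measure \<mu> ({0..1} \<times> {0..1}) = 1 \<and>
     (\<forall>a b. 0 \<le> a \<and> a \<le> b \<and> b \<le> 1 \<longrightarrow>
        measure \<mu> ({a..b} \<times> UNIV) = b - a \<and> measure \<mu> (UNIV \<times> {a..b}) = b - a)"

definition copula_fun :: "(real \<times> real) measure \<Rightarrow> real \<Rightarrow> real \<Rightarrow> real" where
  "copula_fun \<mu> x y = measure \<mu> ({0..x} \<times> {0..y})"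

definition markov_kernel_of :: "(real \<times> real) measure \<Rightarrow> (real \<Rightarrow> real measure) \<Rightarrow> bool" where
  "markov_kernel_of \<mu> K \<longleftrightarrow>
     (\<forall>x\<in>{0..1}. prob_space (K x) \<and> sets (K x) = sets borel \<and> measure (K x) {0..1} = 1) \<and>
     (\<forall>F\<in>sets borel. (\<lambda>x. measure (K x) F) \<in> borel_measurable (restrict_space lborel {0..1})) \<and>
     (\<forall>B\<in>sets borel. \<forall>F\<in>sets borel.
        measure \<mu> (B \<times> F) = (LINT x:(B \<inter> {0..1})|lborel. measure (K x) F))"

definition quantile_kernel :: "real \<Rightarrow> (real \<Rightarrow> real measure) \<Rightarrow> real \<Rightarrow> real" where
  "quantile_kernel \<tau> K x = Inf {y \<in> {0..1}. measure (K x) {0..y} \<ge> \<tau>}"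

definition rank1 :: "nat \<Rightarrow> (nat \<Rightarrow> real \<times> real) \<Rightarrow> nat \<Rightarrow> nat" where
  "rank1 n z k = card {l \<in> {..<n}. fst (z l) \<le> fst (z k)}"

definition rank2 :: "nat \<Rightarrow> (nat \<Rightarrow> real \<times> real) \<Rightarrow> nat \<Rightarrow> nat" where
  "rank2 n z k = card {l \<in> {..<n}. snd (z l) \<le> snd (z k)}"

text \<open>Empirical subcopula on the grid {0,1/n,...,1}^2, as a function of grid indices.\<close>
definition emp_subcopula :: "nat \<Rightarrow> (nat \<Rightarrow> real \<times> real) \<Rightarrow> nat \<Rightarrow> nat \<Rightarrow> real" where
  "emp_subcopula n z i j = real (card {k \<in> {..<n}. rank1 n z k \<le> i \<and> rank2 n z k \<le> j}) / real n"

definition grid_idx :: "nat \<Rightarrow> real \<Rightarrow> nat" where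
  "grid_idx n x = min (nat \<lfloor>real n * x\<rfloor>) (n - 1)"

definition grid_frac :: "nat \<Rightarrow> real \<Rightarrow> real" where
  "grid_frac n x = real n * x - real (grid_idx n x)"

definition emp_copula :: "nat \<Rightarrow> (nat \<Rightarrow> real \<times> real) \<Rightarrow> real \<Rightarrow> real \<Rightarrow> real" where
  "emp_copula n z x y =
     (let i = grid_idx n x; j = grid_idx n y; a = grid_frac n x; b = grid_frac n y;
          E = emp_subcopula n z
      in (1 - a) * (1 - b) * E i j + a * (1 - b) * E (i + 1) j
         + (1 - a) * b * E i (j + 1) + a * b * E (i + 1) (j + 1))"

text \<open>mu_D(I_{N,i} x I_{N,j}) computed from the distribution function D (D-volume of the cell).\<close>
definition cb_mass :: "nat \<Rightarrow> (real \<Rightarrow> real \<Rightarrow> real) \<Rightarrow> nat \<Rightarrow> nat \<Rightarrow> real" where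
  "cb_mass N D i j =
     D (real i / real N) (real j / real N) - D ((real i - 1) / real N) (real j / real N)
     - D (real i / real N) ((real j - 1) / real N) + D ((real i - 1) / real N) ((real j - 1) / real N)"

definition cb_cell :: "nat \<Rightarrow> nat \<Rightarrow> real set" where
  "cb_cell N i = {(real i - 1) / real N <..< real i / real N}"

definition cb_density :: "nat \<Rightarrow> (real \<Rightarrow> real \<Rightarrow> real) \<Rightarrow> real \<times> real \<Rightarrow> real" where
  "cb_density N D p = (real N)\<^sup>2 * (\<Sum>i\<in>{1..N}. \<Sum>j\<in>{1..N}.
       cb_mass N D i j * indicator (cb_cell N i \<times> cb_cell N j) p)"

definition checkerboard :: "nat \<Rightarrow> (real \<Rightarrow> real \<Rightarrow> real) \<Rightarrow> (real \<times> real) measure" where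
  "checkerboard N D = density lborel (\<lambda>p. ennreal (cb_density N D p))"

end

theory Submission
  imports Defs "HOL-Real_Asymp.Real_Asymp"
begin

text \<open>Let \<open>C\<close> be the cdf of \<open>\<mu>\<close>. Hoeffding's inequality on the grid with mesh \<open>1 / n\<close> together with
  Borel--Cantelli gives \<open>sup |E_n - C| = O(n powr - t)\<close> almost surely for every \<open>t < 1 / 2\<close>, so that
  \<open>N(n) * sup |E_n - C|\<close> tends to 0 when \<open>s < 1 / 2\<close>. For \<open>x\<close> in the \<open>i\<close>-th cell the kernel of the checkerboard
  copula at the grid point \<open>j / N\<close> is \<open>N\<close> times the increment of \<open>E_n\<close> over the cell, hence asymptotically
  the difference quotient of \<open>C(\<cdot>, j / N)\<close> over the cell containing \<open>x\<close>. By Lebesgue's differentiation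
  theorem these quotients converge, for almost every \<open>x\<close> and every rational \<open>y\<close>, to
  \<open>\<partial>C(x, y) / \<partial>x = K(x, [0, y])\<close>. Convergence of the conditional cdfs implies convergence of the
  \<open>\<tau>\<close>-quantiles wherever \<open>\<tau> \<mapsto> Q(\<tau>, x)\<close> is right continuous; this holds for almost every \<open>x\<close> unless
  \<open>\<tau>\<close> is one of the countably many discontinuities of the monotone function \<open>\<tau> \<mapsto> \<integral> Q(\<tau>, x) dx\<close>.
  Dominated convergence then gives the \<open>L\<^sup>p\<close> statement.\<close>

section \<open>Empirical copulas\<close>

text \<open>The uniform cdf on the unit interval. It bounds the marginals of a copula measure and,
  after an affine change of variable, is the ramp produced by linear interpolation between grid
  points.\<close>

definition unit_clamp :: "real \<Rightarrow> real" where
  "unit_clamp t = max 0 (min 1 t)"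

lemma unit_clamp_mono: "s \<le> t \<Longrightarrow> unit_clamp s \<le> unit_clamp t"
  by (auto simp: unit_clamp_def)

lemma unit_clamp_nonneg: "0 \<le> unit_clamp t"
  and unit_clamp_le_1: "unit_clamp t \<le> 1"
  by (auto simp: unit_clamp_def)

lemma unit_clamp_diff: "x \<le> x' \<Longrightarrow> unit_clamp x' - unit_clamp x \<le> x' - x"
  by (auto simp: unit_clamp_def)

text \<open>Interpolating a unit step in the grid index gives a ramp: the weight of rank
  \<open>r\<close> rises linearly from 0 at \<open>(r - 1) / n\<close> to 1 at
  \<open>r / n\<close>.\<close>

lemma unit_clamp_interpolation:
  fixes x :: real and n r :: nat
  assumes "0 < n" "0 \<le> x" "x \<le> 1"
  shows "unit_clamp (real n * x - real r + 1) =
    (1 - grid_frac n x) * of_bool (r \<le> grid_idx n x) + grid_frac n x * of_bool (r \<le> grid_idx n x + 1)"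
proof -
  let ?i = "grid_idx n x"
  have frac: "0 \<le> grid_frac n x \<and> grid_frac n x \<le> 1"
  \<comment> \<open>Only at the right end does the \<open>min\<close> in \<open>grid_idx\<close>
    take effect: the index stays at \<open>n - 1\<close> and the fraction becomes 1.\<close>
  proof (cases "x = 1")
    case True
    then have "?i = n - 1" by (simp add: grid_idx_def)
    then show ?thesis using True assms by (simp add: grid_frac_def of_nat_diff)
  next
    case False
    then have "real n * x < real n" using assms by auto
    then have lt: "\<lfloor>real n * x\<rfloor> < int n" by (simp add: floor_less_iff)
    have "0 \<le> real n * x" using assms by simp
    then have nn: "0 \<le> \<lfloor>real n * x\<rfloor>" by simp
    have "?i = nat \<lfloor>real n * x\<rfloor>" using lt nn unfolding grid_idx_def by linarith
    then have "real ?i = of_int \<lfloor>real n * x\<rfloor>" using nn by simp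
    then show ?thesis unfolding grid_frac_def by linarith
  qed
  have "real n * x - real r + 1 = grid_frac n x + real ?i - real r + 1"
    by (simp add: grid_frac_def)
  \<comment> \<open>The middle case is the cell in which the ramp rises; in the others it is
    constantly 1 or 0.\<close>
  moreover consider "r \<le> ?i" "real r \<le> real ?i" | "r = ?i + 1" | "r \<ge> ?i + 2" "real r \<ge> real ?i + 2"
    by linarith
  ultimately show ?thesis
    by cases (use frac in \<open>auto simp: unit_clamp_def\<close>)
qed

text \<open>The indicator of both rank conditions is a product, so interpolating in one coordinate
  leaves the factor of the other untouched.\<close>

lemma emp_subcopula_eq_sum:
  "emp_subcopula n z i j =
     (\<Sum>k<n. of_bool (rank1 n z k \<le> i) * of_bool (rank2 n z k \<le> j)) / real n"
proof -
  have "(\<Sum>k<n. of_bool (rank1 n z k \<le> i) * of_bool (rank2 n z k \<le> j)) =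
      (\<Sum>k<n. of_bool (rank1 n z k \<le> i \<and> rank2 n z k \<le> j) :: real)"
    by (intro sum.cong) auto
  also have "\<dots> = real (card {k \<in> {..<n}. rank1 n z k \<le> i \<and> rank2 n z k \<le> j})"
    by (simp add: of_bool_def sum.If_cases Int_def)
  finally show ?thesis by (simp add: emp_subcopula_def)
qed

text \<open>In this product form each factor is monotone in its own variable, so the
  empirical copula is 2-increasing even if the sample has ties.\<close>

lemma emp_copula_eq_sum:
  assumes "0 < n" "x \<in> {0..1}" "y \<in> {0..1}"
  shows "emp_copula n z x y =
    (\<Sum>k<n. unit_clamp (real n * x - real (rank1 n z k) + 1) *
            unit_clamp (real n * y - real (rank2 n z k) + 1)) / real n"
proof -
  note clamp = unit_clamp_interpolation[OF assms(1)]
  have x: "0 \<le> x" "x \<le> 1" "0 \<le> y" "y \<le> 1" using assms by auto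
  show ?thesis
    unfolding emp_copula_def Let_def emp_subcopula_eq_sum clamp[OF x(1,2)] clamp[OF x(3,4)]
      times_divide_eq_right sum_distrib_left add_divide_distrib[symmetric] sum.distrib[symmetric]
    by (intro arg_cong2[where f = "(/)"] sum.cong refl) (simp only: ring_distribs mult_ac add_ac)
qed

text \<open>A mixed difference of a sum of products is a sum of products of increments, and each
  ramp is monotone. This makes \<open>cb_density\<close> nonnegative, so that \<open>ennreal\<close>
  in \<open>checkerboard\<close> truncates nothing.\<close>

lemma cb_mass_emp_copula_nonneg:
  assumes "0 < n" "i \<in> {1..N}" "j \<in> {1..N}"
  shows "0 \<le> cb_mass N (emp_copula n z) i j"
proof -
  have "0 < N" using assms by auto
  have mem: "real i / real N \<in> {0..1}" "(real i - 1) / real N \<in> {0..1}"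
    "real j / real N \<in> {0..1}" "(real j - 1) / real N \<in> {0..1}"
    using assms by (auto simp: divide_simps)
  let ?f = "\<lambda>x k. unit_clamp (real n * x - real (rank1 n z k) + 1)"
  let ?g = "\<lambda>y k. unit_clamp (real n * y - real (rank2 n z k) + 1)"
  have "cb_mass N (emp_copula n z) i j =
      (\<Sum>k<n. (?f (real i / real N) k - ?f ((real i - 1) / real N) k) *
              (?g (real j / real N) k - ?g ((real j - 1) / real N) k)) / real n"
    unfolding cb_mass_def emp_copula_eq_sum[OF assms(1) mem(1) mem(3)]
      emp_copula_eq_sum[OF assms(1) mem(1) mem(4)] emp_copula_eq_sum[OF assms(1) mem(2) mem(3)]
      emp_copula_eq_sum[OF assms(1) mem(2) mem(4)]
      diff_divide_distrib[symmetric] add_divide_distrib[symmetric] sum_subtractf[symmetric] sum.distrib[symmetric]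
    by (intro arg_cong2[where f = "(/)"] sum.cong refl) (simp only: algebra_simps)
  also have "\<dots> \<ge> 0"
  proof (intro divide_nonneg_nonneg sum_nonneg mult_nonneg_nonneg)
    have le: "(real m - 1) / real N \<le> real m / real N" for m
      by (simp add: divide_right_mono)
    show "0 \<le> ?f (real i / real N) k - ?f ((real i - 1) / real N) k"
      "0 \<le> ?g (real j / real N) k - ?g ((real j - 1) / real N) k" for k
      using mult_left_mono[OF le, of "real n"] by (auto intro!: unit_clamp_mono)
  qed auto
  finally show ?thesis .
qed

text \<open>Lower quadrants instead of rectangles anchored at the origin give a cdf on the whole
  plane, which can be evaluated at shifted points outside the unit square.\<close>

definition joint_cdf :: "(real \<times> real) measure \<Rightarrow> real \<Rightarrow> real \<Rightarrow> real" where
  "joint_cdf \<mu> x y = measure \<mu> ({..x} \<times> {..y})"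

definition emp_cdf :: "nat \<Rightarrow> (nat \<Rightarrow> real \<times> real) \<Rightarrow> real \<Rightarrow> real \<Rightarrow> real" where
  "emp_cdf n z x y = real (card {k \<in> {..<n}. fst (z k) \<le> x \<and> snd (z k) \<le> y}) / real n"

lemma emp_cdf_mono:
  assumes "x \<le> x'" "y \<le> y'"
  shows "emp_cdf n z x y \<le> emp_cdf n z x' y'"
  unfolding emp_cdf_def using assms
  by (intro divide_right_mono of_nat_mono card_mono) auto

lemma Times_borel_real:
  fixes A B :: "real set"
  assumes "A \<in> sets borel" "B \<in> sets borel"
  shows "A \<times> B \<in> sets borel"
  using assms by (metis borel_prod pair_measureI)

section \<open>Copula measures, their joint cdf, and its distance to the empirical copula\<close>

locale copula_measure =
  fixes \<mu> :: "(real \<times> real) measure"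
  assumes is_copula: "is_copula_measure \<mu>"
begin

sublocale prob_space \<mu>
  using is_copula by (simp add: is_copula_measure_def)

lemma sets_copula [simp, measurable_cong]: "sets \<mu> = sets borel"
  using is_copula by (simp add: is_copula_measure_def)

lemma Times_sets_copula: "A \<in> sets borel \<Longrightarrow> B \<in> sets borel \<Longrightarrow> A \<times> B \<in> sets \<mu>"
  by (simp add: Times_borel_real)

lemma AE_unit_square: "AE p in \<mu>. fst p \<in> {0..1} \<and> snd p \<in> {0..1}"
proof -
  have "AE p in \<mu>. p \<in> {0..1} \<times> {0..1}"
    using is_copula by (intro AE_prob_1) (simp add: is_copula_measure_def)
  then show ?thesis by eventually_elim auto
qed

text \<open>The marginals are prescribed on closed subintervals of the unit interval. Since the unit
  square carries all the mass, any strip can be replaced by a clamped closed one.\<close>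

lemma marginal_strip:
  assumes "x \<le> x'"
  shows "measure \<mu> ({x<..x'} \<times> UNIV) \<le> unit_clamp x' - unit_clamp x"
    and "measure \<mu> (UNIV \<times> {x<..x'}) \<le> unit_clamp x' - unit_clamp x"
proof -
  let ?I = "{unit_clamp x..unit_clamp x'}"
  have I: "unit_clamp x \<le> unit_clamp x'" using assms by (rule unit_clamp_mono)
  have meas: "measure \<mu> (?I \<times> UNIV) = unit_clamp x' - unit_clamp x"
    "measure \<mu> (UNIV \<times> ?I) = unit_clamp x' - unit_clamp x"
    using is_copula I unit_clamp_nonneg[of x] unit_clamp_le_1[of x']
    unfolding is_copula_measure_def by blast+
  have sub: "t \<in> {0..1} \<Longrightarrow> t \<in> {x<..x'} \<Longrightarrow> t \<in> ?I" for t
    by (auto simp: unit_clamp_def)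
  have "measure \<mu> ({x<..x'} \<times> UNIV) \<le> measure \<mu> (?I \<times> UNIV)"
    by (intro finite_measure_mono_AE eventually_mono[OF AE_unit_square])
      (use sub in \<open>auto intro: Times_borel_real\<close>)
  then show "measure \<mu> ({x<..x'} \<times> UNIV) \<le> unit_clamp x' - unit_clamp x" using meas by simp
  have "measure \<mu> (UNIV \<times> {x<..x'}) \<le> measure \<mu> (UNIV \<times> ?I)"
    by (intro finite_measure_mono_AE eventually_mono[OF AE_unit_square])
      (use sub in \<open>auto intro: Times_borel_real\<close>)
  then show "measure \<mu> (UNIV \<times> {x<..x'}) \<le> unit_clamp x' - unit_clamp x" using meas by simp
qed

lemma joint_cdf_mono:
  assumes "x \<le> x'" "y \<le> y'"
  shows "joint_cdf \<mu> x y \<le> joint_cdf \<mu> x' y'"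
  unfolding joint_cdf_def using assms
  by (intro finite_measure_mono Times_sets_copula) auto

text \<open>The larger quadrant is covered by the smaller one, a vertical strip and a horizontal
  strip. The clamped increments are kept for \<open>emp_cdf_close_of_grid\<close>, where arguments
  above 1 must cost nothing extra.\<close>

lemma joint_cdf_lipschitz:
  assumes "x \<le> x'" "y \<le> y'"
  shows "joint_cdf \<mu> x' y' \<le>
    joint_cdf \<mu> x y + (unit_clamp x' - unit_clamp x) + (unit_clamp y' - unit_clamp y)"
proof -
  have "joint_cdf \<mu> x' y' \<le>
      measure \<mu> (({..x} \<times> {..y}) \<union> (({x<..x'} \<times> UNIV) \<union> (UNIV \<times> {y<..y'})))"
    unfolding joint_cdf_def
    by (intro finite_measure_mono sets.Un Times_sets_copula) auto
  also have "\<dots> \<le> measure \<mu> ({..x} \<times> {..y}) +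
      (measure \<mu> ({x<..x'} \<times> UNIV) + measure \<mu> (UNIV \<times> {y<..y'}))"
    by (intro order_trans[OF measure_Un_le] add_mono sets.Un Times_sets_copula) auto
  also have "\<dots> \<le> joint_cdf \<mu> x y + (unit_clamp x' - unit_clamp x) + (unit_clamp y' - unit_clamp y)"
    using marginal_strip[OF assms(1)] marginal_strip[OF assms(2)] by (simp add: joint_cdf_def)
  finally show ?thesis .
qed

lemma joint_cdf_lipschitz':
  assumes "x \<le> x'" "y \<le> y'"
  shows "joint_cdf \<mu> x' y' \<le> joint_cdf \<mu> x y + (x' - x) + (y' - y)"
  using joint_cdf_lipschitz[OF assms] unit_clamp_diff[OF assms(1)] unit_clamp_diff[OF assms(2)]
  by linarith

lemma joint_cdf_neg:
  assumes "x < 0 \<or> y < 0"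
  shows "joint_cdf \<mu> x y = 0"
proof -
  have "joint_cdf \<mu> x y = measure \<mu> {}"
    unfolding joint_cdf_def
    by (intro finite_measure_eq_AE eventually_mono[OF AE_unit_square])
      (use assms in \<open>auto intro: Times_borel_real\<close>)
  then show ?thesis by simp
qed

text \<open>Moving the nonpositive argument left by \<open>e\<close> changes the cdf by at most
  \<open>e\<close> and lands where \<open>joint_cdf_neg\<close> applies.\<close>

lemma joint_cdf_zero:
  assumes "x \<le> 0 \<or> y \<le> 0"
  shows "joint_cdf \<mu> x y = 0"
proof -
  have "joint_cdf \<mu> x y \<le> e" if "e > 0" for e
    using joint_cdf_lipschitz'[of "x - e" x y y] joint_cdf_neg[of "x - e" y]
      joint_cdf_lipschitz'[of x x "y - e" y] joint_cdf_neg[of x "y - e"] assms that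
    by fastforce
  then have "joint_cdf \<mu> x y \<le> 0" by (meson dense leD leI)
  then show ?thesis by (simp add: joint_cdf_def measure_le_0_iff)
qed

lemma joint_cdf_marginal:
  assumes "x \<in> {0..1}"
  shows "joint_cdf \<mu> x 1 = x" "joint_cdf \<mu> 1 x = x"
proof -
  have "joint_cdf \<mu> x 1 = measure \<mu> ({0..x} \<times> UNIV)"
    unfolding joint_cdf_def
    by (intro finite_measure_eq_AE eventually_mono[OF AE_unit_square])
      (auto intro: Times_borel_real)
  then show "joint_cdf \<mu> x 1 = x" using is_copula assms by (auto simp: is_copula_measure_def)
  have "joint_cdf \<mu> 1 x = measure \<mu> (UNIV \<times> {0..x})"
    unfolding joint_cdf_def
    by (intro finite_measure_eq_AE eventually_mono[OF AE_unit_square])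
      (auto intro: Times_borel_real)
  then show "joint_cdf \<mu> 1 x = x" using is_copula assms by (auto simp: is_copula_measure_def)
qed

text \<open>The hypotheses enter three times: a rank is \<open>n\<close> times a marginal of the empirical cdf, so
  comparing ranks with grid points shifts each coordinate by \<open>d\<close>, and \<open>d\<close> is lost once more on
  the joint cdf. The term \<open>2 / n\<close> comes from the bilinear interpolation.\<close>

lemma emp_copula_close:
  assumes "0 < n" "0 \<le> d"
    and unit: "\<And>k. fst (z k) \<in> {0..1}" "\<And>k. snd (z k) \<in> {0..1}"
    and upper: "\<And>x y. 0 \<le> x \<Longrightarrow> 0 \<le> y \<Longrightarrow> emp_cdf n z x y \<le> joint_cdf \<mu> x y + d"
    and lower: "\<And>x y. joint_cdf \<mu> x y - d \<le> emp_cdf n z x y"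
    and xy: "x \<in> {0..1}" "y \<in> {0..1}"
  shows "\<bar>emp_copula n z x y - joint_cdf \<mu> x y\<bar> \<le> 3 * d + 2 / real n"
proof -
  let ?f = "\<lambda>k. unit_clamp (real n * x - real (rank1 n z k) + 1)"
  let ?g = "\<lambda>k. unit_clamp (real n * y - real (rank2 n z k) + 1)"
  \<comment> \<open>All sample points lie in the unit square, so bounding the other coordinate by 1
    excludes nothing.\<close>
  have r1: "real (rank1 n z k) = real n * emp_cdf n z (fst (z k)) 1"
    and r2: "real (rank2 n z k) = real n * emp_cdf n z 1 (snd (z k))" for k
    using unit \<open>0 < n\<close> by (auto simp: rank1_def rank2_def emp_cdf_def)
  have F1: "fst (z k) - d \<le> emp_cdf n z (fst (z k)) 1" "emp_cdf n z (fst (z k)) 1 \<le> fst (z k) + d"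
    and F2: "snd (z k) - d \<le> emp_cdf n z 1 (snd (z k))" "emp_cdf n z 1 (snd (z k)) \<le> snd (z k) + d" for k
    using lower[of "fst (z k)" 1] upper[of "fst (z k)" 1] lower[of 1 "snd (z k)"] upper[of 1 "snd (z k)"]
      joint_cdf_marginal[OF unit(1)[of k]] joint_cdf_marginal[OF unit(2)[of k]] unit[of k]
    by auto
  have E: "emp_copula n z x y = (\<Sum>k<n. ?f k * ?g k) / real n"
    using emp_copula_eq_sum[OF \<open>0 < n\<close> xy] .
  have cdf_sum: "emp_cdf n z u v = (\<Sum>k<n. of_bool (fst (z k) \<le> u \<and> snd (z k) \<le> v)) / real n" for u v
    by (simp add: emp_cdf_def of_bool_def sum.If_cases Int_def)
  have pos1: "fst (z k) \<le> x + 1 / real n + d" if "?f k \<noteq> 0" for k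
  proof -
    have "real n * emp_cdf n z (fst (z k)) 1 < real n * x + 1"
      using that r1[of k] by (auto simp: unit_clamp_def split: if_splits)
    then have "emp_cdf n z (fst (z k)) 1 < x + 1 / real n"
      using \<open>0 < n\<close> by (simp add: field_simps)
    then show ?thesis using F1[of k] by linarith
  qed
  have pos2: "snd (z k) \<le> y + 1 / real n + d" if "?g k \<noteq> 0" for k
  proof -
    have "real n * emp_cdf n z 1 (snd (z k)) < real n * y + 1"
      using that r2[of k] by (auto simp: unit_clamp_def split: if_splits)
    then have "emp_cdf n z 1 (snd (z k)) < y + 1 / real n"
      using \<open>0 < n\<close> by (simp add: field_simps)
    then show ?thesis using F2[of k] by linarith
  qed
  have one1: "?f k = 1" if "fst (z k) \<le> x - d" for k
  proof -
    have "emp_cdf n z (fst (z k)) 1 \<le> x" using F1[of k] that by linarith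
    then have "real (rank1 n z k) \<le> real n * x" using r1[of k] by (simp add: mult_left_mono)
    then show ?thesis by (simp add: unit_clamp_def)
  qed
  have one2: "?g k = 1" if "snd (z k) \<le> y - d" for k
  proof -
    have "emp_cdf n z 1 (snd (z k)) \<le> y" using F2[of k] that by linarith
    then have "real (rank2 n z k) \<le> real n * y" using r2[of k] by (simp add: mult_left_mono)
    then show ?thesis by (simp add: unit_clamp_def)
  qed
  have fg: "0 \<le> ?f k * ?g k" "?f k * ?g k \<le> 1" for k
    by (auto intro: mult_nonneg_nonneg mult_le_one simp: unit_clamp_nonneg unit_clamp_le_1)
  let ?x = "x + 1 / real n + d" and ?y = "y + 1 / real n + d"
  \<comment> \<open>A nonzero summand forces its point into the quadrant enlarged by
    \<open>1 / n + d\<close>, and a point of the quadrant shrunk by \<open>d\<close> has weight 1.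
    Hence two empirical cdfs enclose the empirical copula.\<close>
  have "emp_copula n z x y \<le> emp_cdf n z ?x ?y"
    unfolding E cdf_sum
  proof (intro divide_right_mono sum_mono)
    show "?f k * ?g k \<le> of_bool (fst (z k) \<le> ?x \<and> snd (z k) \<le> ?y)" for k
      using fg[of k] pos1[of k] pos2[of k] by (cases "?f k = 0 \<or> ?g k = 0") auto
  qed simp
  also have "\<dots> \<le> joint_cdf \<mu> ?x ?y + d"
    using xy assms(2) by (intro upper) auto
  also have "\<dots> \<le> joint_cdf \<mu> x y + 3 * d + 2 / real n"
    using joint_cdf_lipschitz'[of x ?x y ?y] assms(2) by simp
  finally have up: "emp_copula n z x y \<le> joint_cdf \<mu> x y + 3 * d + 2 / real n" .
  have "joint_cdf \<mu> x y - 3 * d \<le> joint_cdf \<mu> (x - d) (y - d) - d"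
    using joint_cdf_lipschitz'[of "x - d" x "y - d" y] assms(2) by simp
  also have "\<dots> \<le> emp_cdf n z (x - d) (y - d)" by (rule lower)
  also have "\<dots> \<le> emp_copula n z x y"
    unfolding E cdf_sum
  proof (intro divide_right_mono sum_mono)
    show "of_bool (fst (z k) \<le> x - d \<and> snd (z k) \<le> y - d) \<le> ?f k * ?g k" for k
      using fg(1)[of k] one1[of k] one2[of k] by auto
  qed simp
  finally show ?thesis using up by (auto simp: abs_le_iff) (smt (verit) divide_nonneg_nonneg of_nat_0_le_iff)
qed

text \<open>Both cdfs are monotone, so arguments are rounded up for the upper bound and down for the
  lower one. Rounding costs at most \<open>1 / n\<close> per coordinate on the joint cdf.\<close>

lemma emp_cdf_close_of_grid:
  assumes "0 < n" "0 \<le> e"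
    and unit: "\<And>k. fst (z k) \<in> {0..1}" "\<And>k. snd (z k) \<in> {0..1}"
    and grid: "\<And>a b. a \<le> n \<Longrightarrow> b \<le> n \<Longrightarrow>
      \<bar>emp_cdf n z (real a / real n) (real b / real n) - joint_cdf \<mu> (real a / real n) (real b / real n)\<bar> \<le> e"
  shows "0 \<le> x \<Longrightarrow> 0 \<le> y \<Longrightarrow> emp_cdf n z x y \<le> joint_cdf \<mu> x y + (e + 2 / real n)"
    and "joint_cdf \<mu> x y - (e + 2 / real n) \<le> emp_cdf n z x y"
proof -
  have n: "0 < real n" using assms(1) by simp
  \<comment> \<open>Clamping one side covers \<open>t \<ge> 1\<close>: rounding then returns the end
    point 1, beyond which there is neither sample nor mass.\<close>
  have ceil: "\<exists>a\<le>n. real a / real n \<le> t + 1 / real n \<and> unit_clamp t \<le> real a / real n" if "0 \<le> t" for t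
  proof (cases "t \<ge> 1")
    case True
    then show ?thesis using n by (intro exI[of _ n]) (auto simp: unit_clamp_def add_increasing2)
  next
    case False
    define a where "a = nat \<lceil>real n * t\<rceil>"
    have "0 \<le> real n * t" using that n by simp
    then have ra: "real a = of_int \<lceil>real n * t\<rceil>" unfolding a_def by simp
    have nt: "real n * t \<le> real n" using False n by simp
    have "real a \<le> real n * t + 1" "real n * t \<le> real a" unfolding ra by linarith+
    moreover have "a \<le> n" unfolding a_def using nt by (simp add: ceiling_le_iff nat_le_iff)
    ultimately show ?thesis using n False that
      by (intro exI[of _ a]) (auto simp: unit_clamp_def field_simps)
  qed
  have floor: "\<exists>a\<le>n. real a / real n \<le> t \<and> unit_clamp t \<le> real a / real n + 1 / real n" if "0 \<le> t" for t
  proof (cases "t \<ge> 1")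
    case True
    then show ?thesis using n by (intro exI[of _ n]) (auto simp: unit_clamp_def)
  next
    case False
    define a where "a = nat \<lfloor>real n * t\<rfloor>"
    have "0 \<le> real n * t" using that n by simp
    then have ra: "real a = of_int \<lfloor>real n * t\<rfloor>" unfolding a_def by simp
    have nt: "real n * t \<le> real n" using False n by simp
    have "real a \<le> real n * t" "real n * t \<le> real a + 1" unfolding ra by linarith+
    moreover have "a \<le> n" using nt \<open>real a \<le> real n * t\<close> by linarith
    ultimately show ?thesis using n False that
      by (intro exI[of _ a]) (auto simp: unit_clamp_def field_simps)
  qed
  have clamp_id: "unit_clamp (real a / real n) = real a / real n" if "a \<le> n" for a
    using that n by (auto simp: unit_clamp_def)
  show "emp_cdf n z x y \<le> joint_cdf \<mu> x y + (e + 2 / real n)" if "0 \<le> x" "0 \<le> y"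
  proof -
    obtain a where a: "a \<le> n" "real a / real n \<le> x + 1 / real n" "unit_clamp x \<le> real a / real n"
      using ceil[OF \<open>0 \<le> x\<close>] by auto
    obtain b where b: "b \<le> n" "real b / real n \<le> y + 1 / real n" "unit_clamp y \<le> real b / real n"
      using ceil[OF \<open>0 \<le> y\<close>] by auto
    have "fst (z k) \<le> real a / real n" if "fst (z k) \<le> x" for k
      using a that unit(1)[of k] by (auto simp: unit_clamp_def)
    moreover have "snd (z k) \<le> real b / real n" if "snd (z k) \<le> y" for k
      using b that unit(2)[of k] by (auto simp: unit_clamp_def)
    ultimately have "emp_cdf n z x y \<le> emp_cdf n z (real a / real n) (real b / real n)"
      unfolding emp_cdf_def by (intro divide_right_mono of_nat_mono card_mono) auto
    also have "\<dots> \<le> joint_cdf \<mu> (real a / real n) (real b / real n) + e"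
      using grid[OF a(1) b(1)] by linarith
    also have "\<dots> \<le> joint_cdf \<mu> (x + 1 / real n) (y + 1 / real n) + e"
      using joint_cdf_mono[OF a(2) b(2)] by simp
    also have "\<dots> \<le> joint_cdf \<mu> x y + (e + 2 / real n)"
      using joint_cdf_lipschitz'[of x "x + 1 / real n" y "y + 1 / real n"] n by simp
    finally show ?thesis .
  qed
  show "joint_cdf \<mu> x y - (e + 2 / real n) \<le> emp_cdf n z x y"
  \<comment> \<open>A negative argument has no grid point below it, but there the joint cdf vanishes
    and the bound is trivial.\<close>
  proof (cases "0 \<le> x \<and> 0 \<le> y")
    case True
    obtain a where a: "a \<le> n" "real a / real n \<le> x" "unit_clamp x \<le> real a / real n + 1 / real n"
      using floor True by blast
    obtain b where b: "b \<le> n" "real b / real n \<le> y" "unit_clamp y \<le> real b / real n + 1 / real n"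
      using floor True by blast
    have "joint_cdf \<mu> x y - (e + 2 / real n) \<le> joint_cdf \<mu> (real a / real n) (real b / real n) - e"
      using joint_cdf_lipschitz[OF a(2) b(2)] a(3) b(3) clamp_id[OF a(1)] clamp_id[OF b(1)]
      by (simp)
    also have "\<dots> \<le> emp_cdf n z (real a / real n) (real b / real n)"
      using grid[OF a(1) b(1)] by linarith
    also have "\<dots> \<le> emp_cdf n z x y" by (intro emp_cdf_mono a b)
    finally show ?thesis .
  next
    case False
    then have "joint_cdf \<mu> x y = 0" using joint_cdf_neg[of x y] by auto
    moreover have "0 \<le> emp_cdf n z x y" by (simp add: emp_cdf_def)
    ultimately show ?thesis using assms(2) n by (smt (verit) divide_nonneg_pos)
  qed
qed

end

section \<open>Uniform rate of convergence\<close>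

text \<open>The empirical cdf is an average of \<open>n\<close> independent indicators with mean
  \<open>joint_cdf \<mu> x y\<close>. A deviation \<open>e\<close> of the average is
  \<open>n * e\<close> for the sum, so Hoeffding's exponent is
  \<open>2 * (n * e)^2 / n\<close>.\<close>

lemma (in prob_space) emp_cdf_deviation:
  fixes X :: "nat \<Rightarrow> 'a \<Rightarrow> real \<times> real"
  assumes ind: "indep_vars (\<lambda>_. borel) X UNIV"
    and distr: "\<And>i. distr M borel (X i) = \<mu>"
    and n: "0 < n" and e: "0 \<le> e"
  shows "prob {\<omega> \<in> space M. \<bar>emp_cdf n (\<lambda>k. X k \<omega>) x y - joint_cdf \<mu> x y\<bar> \<ge> e}
    \<le> 2 * exp (- 2 * real n * e\<^sup>2)"
proof -
  let ?A = "{..x} \<times> {..y} :: (real \<times> real) set"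
  have A[measurable]: "?A \<in> sets borel" by (intro Times_borel_real) auto
  have X[measurable]: "X k \<in> M \<rightarrow>\<^sub>M borel" for k
    using ind unfolding indep_vars_def by auto
  have ind': "indep_vars (\<lambda>_. borel) (\<lambda>k \<omega>. indicator ?A (X k \<omega>) :: real) {..<n}"
    by (rule indep_vars_compose2[OF indep_vars_subset[OF ind]]) auto
  have E: "expectation (\<lambda>\<omega>. indicator ?A (X k \<omega>)) = joint_cdf \<mu> x y" for k
  proof -
    have "joint_cdf \<mu> x y = prob (X k -` ?A \<inter> space M)"
      unfolding joint_cdf_def distr[of k, symmetric] by (rule measure_distr[OF X A])
    also have "\<dots> = expectation (indicator (X k -` ?A \<inter> space M))" by simp
    also have "\<dots> = expectation (\<lambda>\<omega>. indicator ?A (X k \<omega>))"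
      by (intro Bochner_Integration.integral_cong) (auto simp: indicator_def)
    finally show ?thesis by simp
  qed
  interpret H: Hoeffding_ineq M "{..<n}" "\<lambda>k \<omega>. indicator ?A (X k \<omega>) :: real" "\<lambda>_. 0" "\<lambda>_. 1"
    "\<Sum>k<n. expectation (\<lambda>\<omega>. indicator ?A (X k \<omega>))"
  proof unfold_locales
    show "indep_vars (\<lambda>_. borel) (\<lambda>k \<omega>. indicator ?A (X k \<omega>) :: real) {..<n}" by (rule ind')
    show "AE \<omega> in M. indicator ?A (X k \<omega>) \<in> {0..1::real}" for k
      by (intro AE_I2) (simp add: indicator_def)
  qed simp_all
  have sum: "(\<Sum>k<n. indicator ?A (X k \<omega>)) = real n * emp_cdf n (\<lambda>k. X k \<omega>) x y" for \<omega>
    using n by (simp add: emp_cdf_def indicator_def sum.If_cases Int_def of_bool_def mem_Times_iff)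
  have "{\<omega> \<in> space M. \<bar>emp_cdf n (\<lambda>k. X k \<omega>) x y - joint_cdf \<mu> x y\<bar> \<ge> e} =
      {\<omega> \<in> space M. \<bar>(\<Sum>k<n. indicator ?A (X k \<omega>)) - real n * joint_cdf \<mu> x y\<bar> \<ge> real n * e}"
  proof -
    have "\<bar>real n * u - real n * v\<bar> \<ge> real n * e \<longleftrightarrow> \<bar>u - v\<bar> \<ge> e" for u v
      using n by (simp add: right_diff_distrib[symmetric] abs_mult)
    then show ?thesis by (simp only: sum)
  qed
  also have "prob \<dots> \<le> 2 * exp (- 2 * (real n * e)\<^sup>2 / (\<Sum>k<n. (1 - 0)\<^sup>2))"
    using H.Hoeffding_ineq_abs_ge[of "real n * e"] n e by (simp add: E)
  also have "\<dots> = 2 * exp (- 2 * real n * e\<^sup>2)"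
    using n by (simp add: power2_eq_square)
  finally show ?thesis .
qed

text \<open>The first factor counts grid points, the second is Hoeffding's bound at deviation
  \<open>n powr - t\<close>. The exponent is of order \<open>n powr (1 - 2 * t)\<close>, a positive
  power, which beats any polynomial.\<close>

lemma summable_grid_bound:
  fixes t :: real
  assumes "t < 1 / 2"
  shows "summable (\<lambda>n. (real n + 1)\<^sup>2 * (2 * exp (- 2 * real n * (real n powr - t)\<^sup>2)))"
proof (rule summable_comparison_test_bigo)
  define c where "c = 1 - 2 * t"
  have "c > 0" using assms by (simp add: c_def)
  have "(\<lambda>n. (real n + 1)\<^sup>2 * (2 * exp (- 2 * real n powr c))) \<in> O(\<lambda>n. real n powr - 2)"
    using \<open>c > 0\<close> by real_asymp
  also have "?this \<longleftrightarrow>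
      (\<lambda>n. (real n + 1)\<^sup>2 * (2 * exp (- 2 * real n * (real n powr - t)\<^sup>2))) \<in> O(\<lambda>n. real n powr - 2)"
  proof (intro landau_o.big.in_cong eventually_mono[OF eventually_gt_at_top[of 0]])
    fix n :: nat assume "0 < n"
    then have "real n * (real n powr - t)\<^sup>2 = real n powr c"
      by (simp add: c_def powr_diff powr_minus power_inverse powr_power field_simps)
    then show "(real n + 1)\<^sup>2 * (2 * exp (- 2 * real n powr c)) =
        (real n + 1)\<^sup>2 * (2 * exp (- 2 * real n * (real n powr - t)\<^sup>2))"
      by simp
  qed
  finally show "(\<lambda>n. (real n + 1)\<^sup>2 * (2 * exp (- 2 * real n * (real n powr - t)\<^sup>2))) \<in> O(\<lambda>n. real n powr - 2)" .
  show "summable (\<lambda>n. norm (real n powr - 2))"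
    by (simp add: summable_real_powr_iff)
qed

text \<open>A union bound over the grid, followed by Borel--Cantelli in \<open>n\<close>.\<close>

lemma (in prob_space) emp_cdf_grid_eventually:
  fixes X :: "nat \<Rightarrow> 'a \<Rightarrow> real \<times> real"
  assumes ind: "indep_vars (\<lambda>_. borel) X UNIV"
    and distr: "\<And>i. distr M borel (X i) = \<mu>"
    and t: "t < 1 / 2"
  shows "AE \<omega> in M. \<forall>\<^sub>F n in sequentially. \<forall>a\<le>n. \<forall>b\<le>n.
    \<bar>emp_cdf n (\<lambda>k. X k \<omega>) (real a / real n) (real b / real n) - joint_cdf \<mu> (real a / real n) (real b / real n)\<bar>
      \<le> real n powr - t"
proof -
  define Bad where "Bad n a b = {\<omega> \<in> space M.
    \<bar>emp_cdf n (\<lambda>k. X k \<omega>) (real a / real n) (real b / real n)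
       - joint_cdf \<mu> (real a / real n) (real b / real n)\<bar> \<ge> real n powr - t}" for n a b
  \<comment> \<open>The index 0 is emptied because Hoeffding's bound is available for
    \<open>0 < n\<close>; the claim is about large \<open>n\<close> only.\<close>
  define B where "B n = (if n = 0 then {} else \<Union>p\<in>{..n} \<times> {..n}. Bad n (fst p) (snd p))" for n
  have X[measurable]: "X k \<in> M \<rightarrow>\<^sub>M borel" for k
    using ind unfolding indep_vars_def by auto
  have emp_meas[measurable]: "(\<lambda>\<omega>. emp_cdf n (\<lambda>k. X k \<omega>) x y) \<in> borel_measurable M" for n x y
  proof -
    have "(\<lambda>\<omega>. (\<Sum>k<n. indicator ({..x} \<times> {..y}) (X k \<omega>)) / real n :: real) \<in> borel_measurable M"
      using X Times_borel_real[of "{..x}" "{..y}"] by measurable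
    also have "(\<lambda>\<omega>. (\<Sum>k<n. indicator ({..x} \<times> {..y}) (X k \<omega>)) / real n) =
        (\<lambda>\<omega>. emp_cdf n (\<lambda>k. X k \<omega>) x y)"
      by (simp add: emp_cdf_def indicator_def sum.If_cases Int_def of_bool_def mem_Times_iff)
    finally show ?thesis .
  qed
  have Bad_sets: "Bad n a b \<in> sets M" for n a b
    unfolding Bad_def by measurable
  have B_sets: "B n \<in> sets M" for n
    unfolding B_def using Bad_sets by auto
  have bound: "prob (B n) \<le> (real n + 1)\<^sup>2 * (2 * exp (- 2 * real n * (real n powr - t)\<^sup>2))" for n
  proof (cases "n = 0")
    case False
    have "prob (B n) = prob (\<Union>p\<in>{..n} \<times> {..n}. Bad n (fst p) (snd p))"
      using False by (simp add: B_def)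
    also have "\<dots> \<le> (\<Sum>p\<in>{..n} \<times> {..n}. prob (Bad n (fst p) (snd p)))"
      by (intro measure_UNION_le) (auto intro: Bad_sets)
    also have "\<dots> \<le> (\<Sum>p\<in>{..n} \<times> {..n}. 2 * exp (- 2 * real n * (real n powr - t)\<^sup>2))"
      unfolding Bad_def using False
      by (intro sum_mono emp_cdf_deviation[OF ind distr]) auto
    finally show ?thesis by (simp add: card_cartesian_product power2_eq_square algebra_simps)
  qed (simp add: B_def)
  have "summable (\<lambda>n. prob (B n))"
    by (rule summable_comparison_test'[OF summable_grid_bound[OF t]]) (use bound in auto)
  then have "AE \<omega> in M. \<forall>\<^sub>F n in sequentially. \<omega> \<in> space M - B n"
    by (intro borel_cantelli_AE1 B_sets) (auto simp: emeasure_eq_measure)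
  then show ?thesis
  proof eventually_elim
    case (elim \<omega>)
    from elim eventually_gt_at_top[of 0] show ?case
    proof eventually_elim
      case (elim n)
      then have "\<omega> \<in> space M" "a \<le> n \<Longrightarrow> b \<le> n \<Longrightarrow> \<omega> \<notin> Bad n a b" for a b
        by (auto simp: B_def)
      then show ?case unfolding Bad_def by (simp add: not_le less_imp_le)
    qed
  qed
qed

text \<open>The second factor is the error of \<open>emp_copula_close\<close> when its
  \<open>d\<close> is the error of \<open>emp_cdf_close_of_grid\<close> with
  \<open>e = n powr - t\<close>.\<close>

lemma powr_rate_tendsto_0:
  fixes s t :: real
  assumes "s < t" "s < 1 / 2"
  shows "(\<lambda>n::nat. real n powr s * (3 * (real n powr - t + 2 / real n) + 2 / real n)) \<longlonglongrightarrow> 0"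
proof -
  \<comment> \<open>The coefficient \<open>8 = 3 * 2 + 2\<close> collects the terms of order
    \<open>1 / n\<close>.\<close>
  have "(\<lambda>n. 3 * real n powr - (t - s) + 8 * real n powr - (1 - s)) \<longlonglongrightarrow> 3 * 0 + 8 * 0"
    using assms
    by (intro tendsto_add tendsto_mult_left tendsto_neg_powr filterlim_real_sequentially) auto
  moreover have "\<forall>\<^sub>F n in sequentially. 3 * real n powr - (t - s) + 8 * real n powr - (1 - s) =
      real n powr s * (3 * (real n powr - t + 2 / real n) + 2 / real n)"
    by (rule eventually_mono[OF eventually_gt_at_top[of 0]])
      (simp add: powr_diff powr_minus field_simps)
  ultimately show ?thesis by (auto elim: Lim_transform_eventually)
qed

text \<open>The checkerboard kernel multiplies errors of the empirical copula by the number of cells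
  per side, hence the scaling by \<open>n powr s\<close>.\<close>

lemma (in prob_space) emp_copula_rate:
  fixes X :: "nat \<Rightarrow> 'a \<Rightarrow> real \<times> real" and s :: real
  assumes cop: "is_copula_measure \<mu>"
    and ind: "indep_vars (\<lambda>_. borel) X UNIV"
    and distr: "\<And>i. distr M borel (X i) = \<mu>"
    and s: "s < 1 / 2"
  shows "AE \<omega> in M. \<exists>d. (\<lambda>n. real n powr s * d n) \<longlonglongrightarrow> 0 \<and>
    (\<forall>\<^sub>F n in sequentially. \<forall>x\<in>{0..1}. \<forall>y\<in>{0..1}.
       \<bar>emp_copula n (\<lambda>k. X k \<omega>) x y - joint_cdf \<mu> x y\<bar> \<le> d n)"
proof -
  interpret C: copula_measure \<mu> by standard (rule cop)
  \<comment> \<open>Staying below 1/2 keeps the Hoeffding bounds summable; exceeding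
    \<open>s\<close> makes the scaled error vanish.\<close>
  obtain t where t: "s < t" "t < 1 / 2" using dense s by blast
  define d where "d n = 3 * (real n powr - t + 2 / real n) + 2 / real n" for n :: nat
  have X[measurable]: "X k \<in> M \<rightarrow>\<^sub>M borel" for k
    using ind unfolding indep_vars_def by auto
  have "AE \<omega> in M. fst (X k \<omega>) \<in> {0..1} \<and> snd (X k \<omega>) \<in> {0..1}" for k
  proof -
    have "AE p in distr M borel (X k). fst p \<in> {0..1} \<and> snd p \<in> {0..1}"
      using C.AE_unit_square by (simp only: distr)
    then show ?thesis by (rule AE_distrD[OF X])
  qed
  then have "AE \<omega> in M. \<forall>k. fst (X k \<omega>) \<in> {0..1} \<and> snd (X k \<omega>) \<in> {0..1}"
    by (simp add: AE_all_countable)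
  moreover note emp_cdf_grid_eventually[OF ind distr t(2)]
  ultimately show ?thesis
  proof eventually_elim
    case (elim \<omega>)
    have "(\<lambda>n. real n powr s * d n) \<longlonglongrightarrow> 0"
      unfolding d_def by (rule powr_rate_tendsto_0[OF t(1) s])
    moreover from elim(2) eventually_gt_at_top[of 0]
    have "\<forall>\<^sub>F n in sequentially. \<forall>x\<in>{0..1}. \<forall>y\<in>{0..1}.
        \<bar>emp_copula n (\<lambda>k. X k \<omega>) x y - joint_cdf \<mu> x y\<bar> \<le> d n"
    proof eventually_elim
      case (elim n)
      note unit = \<open>\<forall>k. fst (X k \<omega>) \<in> {0..1} \<and> snd (X k \<omega>) \<in> {0..1}\<close>
      have grid: "\<And>a b. a \<le> n \<Longrightarrow> b \<le> n \<Longrightarrow>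
        \<bar>emp_cdf n (\<lambda>k. X k \<omega>) (real a / real n) (real b / real n)
           - joint_cdf \<mu> (real a / real n) (real b / real n)\<bar> \<le> real n powr - t"
        using elim by blast
      note close = C.emp_cdf_close_of_grid[OF elim(2) powr_ge_zero, where z = "\<lambda>k. X k \<omega>", OF _ _ grid]
      show ?case
        unfolding d_def
        by (intro ballI C.emp_copula_close close) (use unit elim in auto)
    qed
    ultimately show ?case by blast
  qed
qed

section \<open>Differentiation of the joint cdf\<close>

lemma has_real_derivative_of_sided_quotients:
  fixes \<Phi> :: "real \<Rightarrow> real" and x l :: real
  assumes right: "\<And>e. 0 < e \<Longrightarrow> \<exists>d>0. \<forall>h. 0 < h \<and> h < d \<longrightarrow> \<bar>(\<Phi> (x + h) - \<Phi> x) / h - l\<bar> < e"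
    and left: "\<And>e. 0 < e \<Longrightarrow> \<exists>d>0. \<forall>h. 0 < h \<and> h < d \<longrightarrow> \<bar>(\<Phi> x - \<Phi> (x - h)) / h - l\<bar> < e"
  shows "(\<Phi> has_real_derivative l) (at x)"
  unfolding DERIV_def LIM_eq
proof (intro allI impI)
  fix e :: real assume "0 < e"
  obtain d1 where d1: "d1 > 0" "\<And>h. 0 < h \<Longrightarrow> h < d1 \<Longrightarrow> \<bar>(\<Phi> (x + h) - \<Phi> x) / h - l\<bar> < e"
    using right[OF \<open>0 < e\<close>] by auto
  obtain d2 where d2: "d2 > 0" "\<And>h. 0 < h \<Longrightarrow> h < d2 \<Longrightarrow> \<bar>(\<Phi> x - \<Phi> (x - h)) / h - l\<bar> < e"
    using left[OF \<open>0 < e\<close>] by auto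
  show "\<exists>s>0. \<forall>h. h \<noteq> 0 \<and> norm (h - 0) < s \<longrightarrow> norm ((\<Phi> (x + h) - \<Phi> x) / h - l) < e"
  proof (intro exI[of _ "min d1 d2"] conjI allI impI)
    fix h :: real assume h: "h \<noteq> 0 \<and> norm (h - 0) < min d1 d2"
    show "norm ((\<Phi> (x + h) - \<Phi> x) / h - l) < e"
    proof (cases "0 < h")
      case True
      then show ?thesis using d1(2)[of h] h by auto
    next
      case False
      have "(\<Phi> (x + h) - \<Phi> x) / h = (\<Phi> x - \<Phi> (x + h)) / (- h)" by (simp add: divide_simps)
      then show ?thesis using d2(2)[of "- h"] h False by auto
    qed
  qed (use d1 d2 in auto)
qed

text \<open>The cell around \<open>x\<close> need not have \<open>x\<close> as centre or end point.
  First-order expansion at \<open>x\<close> leaves errors proportional to \<open>b - x\<close> and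
  \<open>x - a\<close>, which add up to the length of the cell.\<close>

lemma straddle_quotient_tendsto:
  fixes \<Phi> :: "real \<Rightarrow> real"
  assumes deriv: "(\<Phi> has_real_derivative l) (at x)"
    and ab: "\<forall>\<^sub>F n in F. a n \<le> x \<and> x \<le> b n \<and> a n < b n" and lim: "((\<lambda>n. b n - a n) \<longlongrightarrow> 0) F"
  shows "((\<lambda>n. (\<Phi> (b n) - \<Phi> (a n)) / (b n - a n)) \<longlongrightarrow> l) F"
proof (rule tendstoI)
  fix e :: real assume "0 < e"
  obtain d where d: "d > 0" "\<And>y. \<bar>y - x\<bar> < d \<Longrightarrow> \<bar>\<Phi> y - \<Phi> x - l * (y - x)\<bar> \<le> e / 2 * \<bar>y - x\<bar>"
  proof -
    have "\<forall>e>0. \<exists>d>0. \<forall>y. norm (y - x) < d \<longrightarrow> norm (\<Phi> y - \<Phi> x - l * (y - x)) \<le> e * norm (y - x)"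
      using deriv unfolding has_field_derivative_def has_derivative_at_alt by blast
    then show ?thesis using that \<open>0 < e\<close> by (metis half_gt_zero real_norm_def)
  qed
  have "\<forall>\<^sub>F n in F. b n - a n < d" using order_tendstoD(2)[OF lim d(1)] .
  with ab show "\<forall>\<^sub>F n in F. dist ((\<Phi> (b n) - \<Phi> (a n)) / (b n - a n)) l < e"
  proof eventually_elim
    case (elim n)
    define D where "D = b n - a n"
    have "D > 0" using elim by (simp add: D_def)
    have 1: "\<bar>\<Phi> (b n) - \<Phi> x - l * (b n - x)\<bar> \<le> e / 2 * (b n - x)"
      using d(2)[of "b n"] elim by simp
    have 2: "\<bar>\<Phi> (a n) - \<Phi> x - l * (a n - x)\<bar> \<le> e / 2 * (x - a n)"
      using d(2)[of "a n"] elim by (simp add: abs_minus_commute)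
    have "\<Phi> (b n) - \<Phi> (a n) - l * D = (\<Phi> (b n) - \<Phi> x - l * (b n - x)) - (\<Phi> (a n) - \<Phi> x - l * (a n - x))"
      by (simp add: D_def algebra_simps)
    moreover have "e / 2 * (b n - x) + e / 2 * (x - a n) = e / 2 * D"
      unfolding D_def by (simp only: distrib_left[symmetric]) simp
    ultimately have "\<bar>\<Phi> (b n) - \<Phi> (a n) - l * D\<bar> \<le> e / 2 * D"
      using 1 2 by linarith
    also have "\<dots> < e * D" using \<open>0 < e\<close> \<open>D > 0\<close> by simp
    finally have "\<bar>(\<Phi> (b n) - \<Phi> (a n) - l * D) / D\<bar> < e"
      using \<open>D > 0\<close> by (simp add: abs_divide pos_divide_less_eq)
    moreover have "(\<Phi> (b n) - \<Phi> (a n) - l * D) / D = (\<Phi> (b n) - \<Phi> (a n)) / D - l"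
      using \<open>D > 0\<close> by (simp add: diff_divide_distrib)
    ultimately show ?case by (simp only: dist_real_def D_def)
  qed
qed

lemma set_integral_atMost_diff:
  fixes f :: "real \<Rightarrow> real"
  assumes f: "integrable lborel f" and "a \<le> b"
  shows "(LINT t:{..b}|lborel. f t) - (LINT t:{..a}|lborel. f t) = (LINT t:{a<..b}|lborel. f t)"
    and "(LINT t:{..b}|lborel. f t) - (LINT t:{..a}|lborel. f t) = integral {a..b} f"
proof -
  have int: "set_integrable lborel S f" if "S \<in> sets borel" for S
    using f that unfolding set_integrable_def by (intro integrable_mult_indicator) auto
  have "{..b} = {..a} \<union> {a<..b}" using \<open>a \<le> b\<close> by auto
  then have "(LINT t:{..b}|lborel. f t) = (LINT t:{..a}|lborel. f t) + (LINT t:{a<..b}|lborel. f t)"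
    by (simp only:) (intro set_integral_Un int, auto)
  then show *: "(LINT t:{..b}|lborel. f t) - (LINT t:{..a}|lborel. f t) = (LINT t:{a<..b}|lborel. f t)"
    by simp
  have "(LINT t:{a<..b}|lborel. f t) = (LINT t:{a..b}|lborel. f t)"
  proof (unfold set_lebesgue_integral_def, intro integral_cong_AE)
    show "AE t in lborel. indicator {a<..b} t *\<^sub>R f t = indicator {a..b} t *\<^sub>R f t"
      using AE_lborel_singleton[of a] by eventually_elim (auto simp: indicator_def)
  qed (use f in measurable)
  then show "(LINT t:{..b}|lborel. f t) - (LINT t:{..a}|lborel. f t) = integral {a..b} f"
    using * set_borel_integral_eq_integral(2)[OF int, of "{a..b}"] by simp
qed

text \<open>Lebesgue's differentiation theorem is used for intervals to the right of a point, once
  for \<open>f\<close> and once for its reflection; the latter yields the left-hand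
  quotients.\<close>

lemma AE_has_real_derivative_set_integral_atMost:
  fixes f :: "real \<Rightarrow> real"
  assumes f: "integrable lborel f"
  shows "AE x in lborel. ((\<lambda>u. LINT t:{..u}|lborel. f t) has_real_derivative f x) (at x)"
proof -
  define \<Phi> where "\<Phi> u = (LINT t:{..u}|lborel. f t)" for u
  have diff: "\<Phi> b - \<Phi> a = integral {a..b} f" if "a \<le> b" for a b
    unfolding \<Phi>_def by (rule set_integral_atMost_diff(2)[OF f that])
  have int: "f integrable_on cbox a b" for a b
    using integrable_on_lborel[OF f] by (rule integrable_on_subcbox) simp
  have int_refl: "(\<lambda>t. f (- t)) integrable_on cbox a b" for a b
    using int[of "- b" "- a"] Henstock_Kurzweil_Integration.integrable_reflect_real[of f "- a" "- b"] by simp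
  obtain N1 where N1: "negligible N1" and right: "\<And>x e. x \<notin> N1 \<Longrightarrow> 0 < e \<Longrightarrow>
      \<exists>d>0. \<forall>h. 0 < h \<and> h < d \<longrightarrow> norm (integral (cbox x (x + h *\<^sub>R One)) f /\<^sub>R h ^ DIM(real) - f x) < e"
    by (rule integrable_ccontinuous_explicit[OF int]) blast
  obtain N2 where N2: "negligible N2" and left: "\<And>x e. x \<notin> N2 \<Longrightarrow> 0 < e \<Longrightarrow>
      \<exists>d>0. \<forall>h. 0 < h \<and> h < d \<longrightarrow>
        norm (integral (cbox x (x + h *\<^sub>R One)) (\<lambda>t. f (- t)) /\<^sub>R h ^ DIM(real) - f (- x)) < e"
    by (rule integrable_ccontinuous_explicit[OF int_refl]) blast
  \<comment> \<open>The exceptional set of the reflected function must be reflected back, which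
    keeps it null.\<close>
  have "negligible (uminus ` N2)"
    by (rule negligible_differentiable_image_negligible[OF _ N2])
      (auto intro!: differentiable_on_minus differentiable_on_id simp: differentiable_on_def)
  with N1 have "negligible (N1 \<union> uminus ` N2)" by (rule negligible_Un)
  then have "AE x in lebesgue. x \<notin> N1 \<union> uminus ` N2"
    by (intro AE_not_in) (simp add: negligible_iff_null_sets)
  then have "AE x in lborel. x \<notin> N1 \<union> uminus ` N2"
    by (simp only: AE_completion_iff)
  then show ?thesis
    unfolding \<Phi>_def[symmetric]
  proof eventually_elim
    case (elim x)
    then have x1: "x \<notin> N1" and x2: "- x \<notin> N2" by force+
    show ?case
    proof (rule has_real_derivative_of_sided_quotients)
      fix e :: real assume e: "0 < e"
      show "\<exists>d>0. \<forall>h. 0 < h \<and> h < d \<longrightarrow> \<bar>(\<Phi> (x + h) - \<Phi> x) / h - f x\<bar> < e"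
        using right[OF x1 e] by (auto simp: diff field_simps)
      have eq: "\<Phi> x - \<Phi> (x - h) = integral {- x..- x + h} (\<lambda>t. f (- t))" if "0 < h" for h
        using diff[of "x - h" x] Henstock_Kurzweil_Integration.integral_reflect_real[of x "x - h" f] that by simp
      obtain d where d: "0 < d"
        "\<And>h. 0 < h \<Longrightarrow> h < d \<Longrightarrow> \<bar>integral {- x..- x + h} (\<lambda>t. f (- t)) / h - f x\<bar> < e"
        using left[OF x2 e] by (auto simp: divide_inverse mult.commute)
      show "\<exists>d>0. \<forall>h. 0 < h \<and> h < d \<longrightarrow> \<bar>(\<Phi> x - \<Phi> (x - h)) / h - f x\<bar> < e"
        by (intro exI[of _ d] conjI allI impI d(1)) (use d(2) eq in simp)
    qed
  qed
qed

text \<open>A kernel is constrained on the unit interval only, so it is cut off there before being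
  integrated over the line.\<close>

lemma markov_kernel_of_integrable:
  assumes K: "markov_kernel_of \<mu> K" and F: "F \<in> sets borel"
  shows "integrable lborel (\<lambda>t. indicator {0..1} t * measure (K t) F)"
proof -
  have meas: "(\<lambda>t. indicator {0..1} t * measure (K t) F) \<in> borel_measurable lborel"
    using K F borel_measurable_restrict_space_iff[of "{0..1}" lborel "\<lambda>t. measure (K t) F"]
    by (simp add: markov_kernel_of_def)
  show ?thesis
  proof (rule Bochner_Integration.integrable_bound[OF _ meas])
    show "integrable lborel (indicator {0..1} :: real \<Rightarrow> real)" by simp
    show "AE t in lborel. norm (indicator {0..1} t * measure (K t) F) \<le> norm (indicator {0..1} t :: real)"
    proof (intro AE_I2)
      fix t :: real
      have "t \<in> {0..1} \<Longrightarrow> measure (K t) F \<le> 1"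
        using K by (auto simp: markov_kernel_of_def intro: prob_space.prob_le_1)
      then show "norm (indicator {0..1} t * measure (K t) F) \<le> norm (indicator {0..1} t :: real)"
        by (auto simp: indicator_def)
    qed
  qed
qed

lemma (in copula_measure) joint_cdf_eq_integral:
  assumes K: "markov_kernel_of \<mu> K"
  shows "joint_cdf \<mu> x y = (LINT t:{..x}|lborel. indicator {0..1} t * measure (K t) {0..y})"
proof -
  have "joint_cdf \<mu> x y = measure \<mu> ({..x} \<times> {0..y})"
    unfolding joint_cdf_def
    by (intro finite_measure_eq_AE eventually_mono[OF AE_unit_square])
      (auto intro: Times_borel_real)
  also have "\<dots> = (LINT t:({..x} \<inter> {0..1})|lborel. measure (K t) {0..y})"
    using K by (simp add: markov_kernel_of_def)
  also have "\<dots> = (LINT t:{..x}|lborel. indicator {0..1} t * measure (K t) {0..y})"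
    unfolding set_lebesgue_integral_def
    by (intro Bochner_Integration.integral_cong) (auto simp: indicator_def)
  finally show ?thesis .
qed

text \<open>The null set of the differentiation theorem depends on \<open>y\<close>, so only
  countably many heights can be treated at once. Rationals suffice because cdfs are monotone in
  \<open>y\<close>.\<close>

lemma (in copula_measure) AE_joint_cdf_derivative:
  assumes K: "markov_kernel_of \<mu> K"
  shows "AE x in lborel. x \<in> {0..1} \<longrightarrow>
    (\<forall>y\<in>\<rat>. ((\<lambda>u. joint_cdf \<mu> u y) has_real_derivative measure (K x) {0..y}) (at x))"
proof -
  have "AE x in lborel. x \<in> {0..1} \<longrightarrow>
      ((\<lambda>u. joint_cdf \<mu> u y) has_real_derivative measure (K x) {0..y}) (at x)" for y
    using AE_has_real_derivative_set_integral_atMost[OF markov_kernel_of_integrable[OF K, of "{0..y}"]]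
    unfolding joint_cdf_eq_integral[OF K, symmetric] by (auto elim!: eventually_mono)
  then have "AE x in lborel. \<forall>y\<in>\<rat>. x \<in> {0..1} \<longrightarrow>
      ((\<lambda>u. joint_cdf \<mu> u y) has_real_derivative measure (K x) {0..y}) (at x)"
    by (subst AE_ball_countable) (auto simp: countable_rat)
  then show ?thesis by eventually_elim auto
qed

section \<open>Kernels of checkerboard copulas\<close>

lemma cb_cell_sets [measurable]: "cb_cell N i \<in> sets borel"
  by (simp add: cb_cell_def)

text \<open>A grid point never cuts an open cell, so the interval up to it contains the cell or
  misses it. This makes the kernel explicit at grid points.\<close>

lemma measure_cb_cell_Int:
  assumes "0 < N" "j \<in> {1..N}" "J \<le> N"
  shows "measure lborel ({0..real J / real N} \<inter> cb_cell N j) = (if j \<le> J then 1 / real N else 0)"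
proof (cases "j \<le> J")
  case True
  have "0 \<le> (real j - 1) / real N" "real j / real N \<le> real J / real N"
    using assms True by (auto simp: divide_right_mono)
  then have "{0..real J / real N} \<inter> cb_cell N j = cb_cell N j"
    unfolding cb_cell_def by fastforce
  then show ?thesis using True assms by (simp add: cb_cell_def diff_divide_distrib)
next
  case False
  then have "real J \<le> real j - 1" by linarith
  then have "real J / real N \<le> (real j - 1) / real N" by (simp add: divide_right_mono)
  then have "{0..real J / real N} \<inter> cb_cell N j = {}"
    by (auto simp: cb_cell_def)
  then show ?thesis using False by simp
qed

lemma cb_cell_inter_finite: "emeasure lborel (A \<inter> cb_cell N i) < \<infinity>" if "A \<in> sets borel"
proof -
  have "emeasure lborel (A \<inter> cb_cell N i) \<le> emeasure lborel (cb_cell N i)"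
    by (intro emeasure_mono) auto
  also have "\<dots> < \<infinity>"
    by (simp add: cb_cell_def divide_right_mono)
  finally show ?thesis .
qed

lemma sum_sum_ennreal:
  assumes "\<And>i j. i \<in> I \<Longrightarrow> j \<in> J \<Longrightarrow> 0 \<le> f i j"
  shows "(\<Sum>i\<in>I. \<Sum>j\<in>J. ennreal (f i j)) = ennreal (\<Sum>i\<in>I. \<Sum>j\<in>J. f i j)"
proof -
  have "(\<Sum>i\<in>I. \<Sum>j\<in>J. ennreal (f i j)) = (\<Sum>i\<in>I. ennreal (\<Sum>j\<in>J. f i j))"
    using assms by (intro sum.cong refl sum_ennreal) auto
  also have "\<dots> = ennreal (\<Sum>i\<in>I. \<Sum>j\<in>J. f i j)"
    using assms by (intro sum_ennreal sum_nonneg) auto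
  finally show ?thesis .
qed

text \<open>The density is a combination of indicators of cells, and Lebesgue measure is a product.
  Nonnegative masses let the real sum pass through \<open>ennreal\<close>.\<close>

lemma measure_checkerboard_Times:
  assumes nonneg: "\<And>i j. i \<in> {1..N} \<Longrightarrow> j \<in> {1..N} \<Longrightarrow> 0 \<le> cb_mass N D i j"
    and A: "A \<in> sets borel" and B: "B \<in> sets borel"
  shows "measure (checkerboard N D) (A \<times> B) = (real N)\<^sup>2 * (\<Sum>i\<in>{1..N}. \<Sum>j\<in>{1..N}.
    cb_mass N D i j * measure lborel (A \<inter> cb_cell N i) * measure lborel (B \<inter> cb_cell N j))"
    (is "_ = ?r")
proof -
  let ?I = "\<lambda>i j. (A \<inter> cb_cell N i) \<times> (B \<inter> cb_cell N j)"
  have I_sets: "?I i j \<in> sets lborel" for i j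
    using Times_borel_real[of "A \<inter> cb_cell N i" "B \<inter> cb_cell N j"] A B by simp
  have cells: "cb_cell N i \<times> cb_cell N j \<in> sets borel" for i j
    by (intro Times_borel_real cb_cell_sets)
  have dens[measurable]: "(\<lambda>p. ennreal (cb_density N D p)) \<in> borel_measurable lborel"
    unfolding cb_density_def using cells by measurable
  have AB: "A \<times> B \<in> sets lborel" using Times_borel_real[OF A B] by simp
  have pt: "ennreal (cb_density N D p) * indicator (A \<times> B) p =
      (\<Sum>i\<in>{1..N}. \<Sum>j\<in>{1..N}. ennreal ((real N)\<^sup>2 * cb_mass N D i j) * indicator (?I i j) p)" for p
  proof -
    have "ennreal (cb_density N D p) * indicator (A \<times> B) p =
        ennreal (cb_density N D p * indicator (A \<times> B) p)"
      by (simp add: indicator_def)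
    also have "cb_density N D p * indicator (A \<times> B) p =
        (\<Sum>i\<in>{1..N}. \<Sum>j\<in>{1..N}. (real N)\<^sup>2 * cb_mass N D i j * indicator (?I i j) p)"
      unfolding cb_density_def sum_distrib_left sum_distrib_right
      by (intro sum.cong refl) (auto simp: indicator_def)
    also have "ennreal \<dots> =
        (\<Sum>i\<in>{1..N}. \<Sum>j\<in>{1..N}. ennreal ((real N)\<^sup>2 * cb_mass N D i j * indicator (?I i j) p))"
      by (rule sum_sum_ennreal[symmetric]) (use nonneg in simp)
    also have "\<dots> = (\<Sum>i\<in>{1..N}. \<Sum>j\<in>{1..N}. ennreal ((real N)\<^sup>2 * cb_mass N D i j) * indicator (?I i j) p)"
      by (intro sum.cong refl) (auto simp: indicator_def)
    finally show ?thesis .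
  qed
  have em: "emeasure lborel (?I i j) =
      ennreal (measure lborel (A \<inter> cb_cell N i) * measure lborel (B \<inter> cb_cell N j))" for i j
  proof -
    have "emeasure lborel (?I i j) = emeasure lborel (A \<inter> cb_cell N i) * emeasure lborel (B \<inter> cb_cell N j)"
      unfolding lborel_prod[symmetric] using A B by (intro lborel.emeasure_pair_measure_Times) auto
    then show ?thesis
      using cb_cell_inter_finite[OF A, of N i] cb_cell_inter_finite[OF B, of N j]
      by (simp add: emeasure_eq_ennreal_measure ennreal_mult less_top)
  qed
  have "emeasure (checkerboard N D) (A \<times> B) = (\<integral>\<^sup>+p. ennreal (cb_density N D p) * indicator (A \<times> B) p \<partial>lborel)"
    unfolding checkerboard_def using AB by (intro emeasure_density dens)
  also have "\<dots> = (\<Sum>i\<in>{1..N}. \<Sum>j\<in>{1..N}. ennreal ((real N)\<^sup>2 * cb_mass N D i j) * emeasure lborel (?I i j))"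
  proof -
    have meas: "(\<lambda>p. ennreal ((real N)\<^sup>2 * cb_mass N D i j) * indicator (?I i j) p) \<in> borel_measurable lborel" for i j
      by (intro borel_measurable_times_ennreal borel_measurable_indicator I_sets) simp
    show ?thesis
      unfolding pt
      by (simp only: nn_integral_sum meas borel_measurable_sum nn_integral_cmult_indicator I_sets)
  qed
  also have "\<dots> = (\<Sum>i\<in>{1..N}. \<Sum>j\<in>{1..N}. ennreal ((real N)\<^sup>2 *
      (cb_mass N D i j * measure lborel (A \<inter> cb_cell N i) * measure lborel (B \<inter> cb_cell N j))))"
    unfolding em using nonneg
    by (intro sum.cong refl) (simp add: ennreal_mult'[symmetric] mult_ac)
  also have "\<dots> = ennreal (\<Sum>i\<in>{1..N}. \<Sum>j\<in>{1..N}. (real N)\<^sup>2 *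
      (cb_mass N D i j * measure lborel (A \<inter> cb_cell N i) * measure lborel (B \<inter> cb_cell N j)))"
    by (rule sum_sum_ennreal) (use nonneg in simp)
  also have "(\<Sum>i\<in>{1..N}. \<Sum>j\<in>{1..N}. (real N)\<^sup>2 *
      (cb_mass N D i j * measure lborel (A \<inter> cb_cell N i) * measure lborel (B \<inter> cb_cell N j))) = ?r"
    by (simp add: sum_distrib_left)
  finally have "emeasure (checkerboard N D) (A \<times> B) = ennreal ?r" .
  moreover have "0 \<le> ?r" using nonneg by (intro mult_nonneg_nonneg sum_nonneg) auto
  ultimately show ?thesis by (simp add: measure_def)
qed

text \<open>Integrated over any Borel set \<open>A\<close>, both the kernel and the step function
  \<open>g\<close> give the mass of \<open>A \<times> {0..J / N}\<close>, so they agree almost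
  everywhere.\<close>

lemma AE_checkerboard_kernel:
  assumes nonneg: "\<And>i j. i \<in> {1..N} \<Longrightarrow> j \<in> {1..N} \<Longrightarrow> 0 \<le> cb_mass N D i j"
    and K: "markov_kernel_of (checkerboard N D) K" and N: "0 < N" and J: "J \<le> N"
  shows "AE x in lborel. \<forall>i\<in>{1..N}. x \<in> cb_cell N i \<longrightarrow>
    measure (K x) {0..real J / real N} = real N * (\<Sum>j\<in>{1..J}. cb_mass N D i j)"
proof -
  let ?F = "{0..real J / real N}"
  let ?c = "\<lambda>i. real N * (\<Sum>j\<in>{1..J}. cb_mass N D i j)"
  define g where "g x = (\<Sum>i\<in>{1..N}. ?c i * indicator (cb_cell N i) x)" for x :: real
  have int_cell: "integrable lborel (\<lambda>x. ?c i * indicator (A \<inter> cb_cell N i) x)" if "A \<in> sets borel" for i A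
    using that cb_cell_inter_finite[OF that, of N i]
    by (intro integrable_mult_right integrable_real_indicator) auto
  have g: "integrable lborel g"
    unfolding g_def using int_cell[of UNIV] by (intro Bochner_Integration.integrable_sum) simp
  have "AE x in lborel. indicator {0..1} x * measure (K x) ?F = g x"
  proof (rule density_unique_real[OF markov_kernel_of_integrable[OF K] g])
    fix A :: "real set" assume "A \<in> sets lborel"
    then have A: "A \<in> sets borel" by simp
    have "(LINT x:A|lborel. indicator {0..1} x * measure (K x) ?F) =
        (LINT x:(A \<inter> {0..1})|lborel. measure (K x) ?F)"
      unfolding set_lebesgue_integral_def
      by (intro Bochner_Integration.integral_cong) (auto simp: indicator_def)
    also have "\<dots> = measure (checkerboard N D) (A \<times> ?F)"
      using K A by (simp add: markov_kernel_of_def)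
    also have "\<dots> = (real N)\<^sup>2 * (\<Sum>i\<in>{1..N}. \<Sum>j\<in>{1..N}.
        cb_mass N D i j * measure lborel (A \<inter> cb_cell N i) * measure lborel (?F \<inter> cb_cell N j))"
      by (rule measure_checkerboard_Times[OF nonneg A]) auto
    also have "\<dots> = (\<Sum>i\<in>{1..N}. ?c i * measure lborel (A \<inter> cb_cell N i))"
      unfolding sum_distrib_left
    proof (intro sum.cong refl)
      fix i assume "i \<in> {1..N}"
      \<comment> \<open>Each full cell has height \<open>1 / N\<close>, which cancels one of the two
        factors \<open>N\<close>.\<close>
      have "(\<Sum>j\<in>{1..N}. (real N)\<^sup>2 * (cb_mass N D i j * measure lborel (A \<inter> cb_cell N i) *
            measure lborel (?F \<inter> cb_cell N j))) =
          (\<Sum>j\<in>{1..N}. if j \<le> J then real N * cb_mass N D i j * measure lborel (A \<inter> cb_cell N i) else 0)"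
        using N J by (intro sum.cong refl, subst measure_cb_cell_Int) (auto simp: power2_eq_square)
      also have "\<dots> = (\<Sum>j\<in>{1..J}. real N * cb_mass N D i j * measure lborel (A \<inter> cb_cell N i))"
        using J by (intro sum.mono_neutral_cong_right) auto
      finally show "(\<Sum>j\<in>{1..N}. (real N)\<^sup>2 * (cb_mass N D i j * measure lborel (A \<inter> cb_cell N i) *
            measure lborel (?F \<inter> cb_cell N j))) = (\<Sum>j\<in>{1..J}. real N * cb_mass N D i j) * measure lborel (A \<inter> cb_cell N i)"
        by (simp add: sum_distrib_right)
    qed
    also have "\<dots> = (\<Sum>i\<in>{1..N}. LINT x|lborel. ?c i * indicator (A \<inter> cb_cell N i) x)"
      by (simp)
    also have "\<dots> = (LINT x|lborel. (\<Sum>i\<in>{1..N}. ?c i * indicator (A \<inter> cb_cell N i) x))"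
      by (rule Bochner_Integration.integral_sum[symmetric]) (rule int_cell[OF A])
    also have "\<dots> = (LINT x:A|lborel. g x)"
      unfolding set_lebesgue_integral_def g_def
      by (intro Bochner_Integration.integral_cong) (auto simp: sum_distrib_left indicator_inter_arith mult_ac)
    finally show "(LINT x:A|lborel. indicator {0..1} x * measure (K x) ?F) = (LINT x:A|lborel. g x)" .
  qed auto
  then show ?thesis
  proof eventually_elim
    case (elim x)
    show ?case
    proof (intro ballI impI)
      fix i assume i: "i \<in> {1..N}" "x \<in> cb_cell N i"
      have "0 < x" "x < 1"
      proof -
        have "0 \<le> (real i - 1) / real N" using i by simp
        then show "0 < x" using i(2) unfolding cb_cell_def by (meson greaterThanLessThan_iff le_less_trans)
        have "real i / real N \<le> 1" using i N by (simp add: divide_simps)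
        then show "x < 1" using i(2) unfolding cb_cell_def by (meson greaterThanLessThan_iff less_le_trans)
      qed
      \<comment> \<open>Cells are disjoint, so a single term of \<open>g x\<close> survives.\<close>
      have "x \<notin> cb_cell N i'" if "i' \<noteq> i" for i'
      proof
        assume "x \<in> cb_cell N i'"
        then have "real i' - 1 < real N * x" "real N * x < real i'" "real i - 1 < real N * x" "real N * x < real i"
          using i N by (auto simp: cb_cell_def field_simps)
        then have "i' = i" by linarith
        with that show False by simp
      qed
      then have "g x = (\<Sum>i'\<in>{1..N}. if i' = i then ?c i else 0)"
        unfolding g_def using i(2) by (intro sum.cong) (auto simp: indicator_def)
      also have "\<dots> = ?c i" using i by simp
      finally show "measure (K x) ?F = ?c i" using elim \<open>0 < x\<close> \<open>x < 1\<close> by simp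
    qed
  qed
qed

section \<open>Quantiles\<close>

text \<open>Quantiles of plain functions keep the limit argument free of kernels. The condition
  \<open>\<tau> \<le> F 1\<close> in several lemmas below ensures that the infimum is over a
  nonempty set.\<close>

definition quantile_of :: "real \<Rightarrow> (real \<Rightarrow> real) \<Rightarrow> real" where
  "quantile_of \<tau> F = Inf {y \<in> {0..1}. F y \<ge> \<tau>}"

lemma quantile_kernel_eq: "quantile_kernel \<tau> K x = quantile_of \<tau> (\<lambda>y. measure (K x) {0..y})"
  by (simp add: quantile_kernel_def quantile_of_def)

lemma quantile_of_le: "y \<in> {0..1} \<Longrightarrow> \<tau> \<le> F y \<Longrightarrow> quantile_of \<tau> F \<le> y"
  unfolding quantile_of_def by (intro cInf_lower bdd_belowI[of _ 0]) auto

lemma less_of_less_quantile_of: "y \<in> {0..1} \<Longrightarrow> y < quantile_of \<tau> F \<Longrightarrow> F y < \<tau>"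
  using quantile_of_le[of y \<tau> F] by (auto simp: not_le[symmetric])

lemma quantile_of_ge:
  assumes "\<tau> \<le> F 1" "\<And>y. y \<in> {0..1} \<Longrightarrow> \<tau> \<le> F y \<Longrightarrow> u \<le> y"
  shows "u \<le> quantile_of \<tau> F"
  unfolding quantile_of_def using assms by (intro cInf_greatest) auto

lemma quantile_of_less_iff:
  assumes "\<tau> \<le> F 1"
  shows "quantile_of \<tau> F < u \<longleftrightarrow> (\<exists>y\<in>{0..1}. y < u \<and> \<tau> \<le> F y)"
  using quantile_of_ge[of \<tau> F u] quantile_of_le[of _ \<tau> F] assms
  by (meson le_less_trans not_le)

lemma quantile_of_unit:
  assumes "\<tau> \<le> F 1"
  shows "0 \<le> quantile_of \<tau> F" "quantile_of \<tau> F \<le> 1"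
  using quantile_of_ge[of \<tau> F 0] quantile_of_le[of 1 \<tau> F] assms by auto

lemma quantile_of_mono:
  assumes "\<tau> \<le> \<tau>'" "\<tau>' \<le> F 1"
  shows "quantile_of \<tau> F \<le> quantile_of \<tau>' F"
  using assms by (intro quantile_of_ge quantile_of_le) auto

text \<open>By monotonicity a witness can be raised to a rational one still below \<open>u\<close>;
  \<open>u \<le> 1\<close> keeps it in the unit interval. Countability then gives measurability and
  comparison along rationals.\<close>

lemma quantile_of_less_rat_iff:
  assumes mono: "\<And>y y'. 0 \<le> y \<Longrightarrow> y \<le> y' \<Longrightarrow> F y \<le> F y'" and "\<tau> \<le> F 1" "u \<le> 1"
  shows "quantile_of \<tau> F < u \<longleftrightarrow> (\<exists>y\<in>{0..1} \<inter> \<rat>. y < u \<and> \<tau> \<le> F y)"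
proof
  assume "quantile_of \<tau> F < u"
  then obtain y where y: "y \<in> {0..1}" "y < u" "\<tau> \<le> F y"
    using quantile_of_less_iff[where F = F, OF assms(2)] by blast
  obtain r where r: "r \<in> \<rat>" "y < r" "r < u" using Rats_dense_in_real[OF y(2)] by blast
  have "\<tau> \<le> F r" using mono[of y r] y r by auto
  then show "\<exists>y\<in>{0..1} \<inter> \<rat>. y < u \<and> \<tau> \<le> F y" using r y assms(3) by (intro bexI[of _ r]) auto
qed (use quantile_of_less_iff[where F = F, OF assms(2)] in blast)

text \<open>Both quantiles are at most 1, so they coincide once they satisfy the same strict bounds
  \<open>u \<le> 1\<close>, and these depend on rational arguments only.\<close>

lemma quantile_of_cong_rat:
  assumes F: "\<And>y y'. 0 \<le> y \<Longrightarrow> y \<le> y' \<Longrightarrow> F y \<le> F y'" "\<tau> \<le> F 1"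
    and G: "\<And>y y'. 0 \<le> y \<Longrightarrow> y \<le> y' \<Longrightarrow> G y \<le> G y'" "\<tau> \<le> G 1"
    and eq: "\<And>y. y \<in> \<rat> \<Longrightarrow> F y = G y"
  shows "quantile_of \<tau> F = quantile_of \<tau> G"
proof -
  have "quantile_of \<tau> F < u \<longleftrightarrow> quantile_of \<tau> G < u" if "u \<le> 1" for u
  proof -
    have "quantile_of \<tau> F < u \<longleftrightarrow> (\<exists>y\<in>{0..1} \<inter> \<rat>. y < u \<and> \<tau> \<le> F y)"
      by (rule quantile_of_less_rat_iff) (use F that in auto)
    also have "\<dots> \<longleftrightarrow> (\<exists>y\<in>{0..1} \<inter> \<rat>. y < u \<and> \<tau> \<le> G y)"
      using eq by auto
    also have "\<dots> \<longleftrightarrow> quantile_of \<tau> G < u"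
      by (rule quantile_of_less_rat_iff[symmetric]) (use G that in auto)
    finally show ?thesis .
  qed
  then show ?thesis
    using quantile_of_unit(2)[where F = F, OF F(2)] quantile_of_unit(2)[where F = G, OF G(2)] by (metis less_irrefl linorder_cases)
qed

text \<open>The limit is compared with \<open>Fn\<close> at two different rationals, which leaves
  room for rounding to the grid. Kernels are given for \<open>1 \<le> n\<close> only, hence the
  guards on \<open>n\<close>.\<close>

lemma quantile_of_tendsto:
  fixes Fn :: "nat \<Rightarrow> real \<Rightarrow> real"
  assumes F1: "F 1 = 1" and Fn1: "\<And>n. 1 \<le> n \<Longrightarrow> Fn n 1 = 1"
    and Fn_mono: "\<And>n y y'. 1 \<le> n \<Longrightarrow> 0 \<le> y \<Longrightarrow> y \<le> y' \<Longrightarrow> Fn n y \<le> Fn n y'"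
    and Fmono: "\<And>y y'. 0 \<le> y \<Longrightarrow> y \<le> y' \<Longrightarrow> F y \<le> F y'"
    and low: "\<And>y y' e. y \<in> \<rat> \<Longrightarrow> y' \<in> \<rat> \<Longrightarrow> 0 \<le> y \<Longrightarrow> y < y' \<Longrightarrow> y' \<le> 1 \<Longrightarrow> 0 < e \<Longrightarrow>
      \<forall>\<^sub>F n in sequentially. F y - e < Fn n y'"
    and up: "\<And>y y' e. y \<in> \<rat> \<Longrightarrow> y' \<in> \<rat> \<Longrightarrow> 0 \<le> y \<Longrightarrow> y < y' \<Longrightarrow> y' \<le> 1 \<Longrightarrow> 0 < e \<Longrightarrow>
      \<forall>\<^sub>F n in sequentially. Fn n y < F y' + e"
    and \<tau>: "\<tau> < 1"
    and right_cont: "\<And>e. 0 < e \<Longrightarrow> \<exists>\<tau>'>\<tau>. \<tau>' < 1 \<and> quantile_of \<tau>' F < quantile_of \<tau> F + e"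
  shows "(\<lambda>n. quantile_of \<tau> (Fn n)) \<longlonglongrightarrow> quantile_of \<tau> F"
proof (rule order_tendstoI)
  have n1: "\<forall>\<^sub>F n in sequentially. (1::nat) \<le> n" by (rule eventually_ge_at_top)
  have Q: "0 \<le> quantile_of \<tau> F" "quantile_of \<tau> F \<le> 1"
    using quantile_of_unit[of \<tau> F] F1 \<tau> by auto
  fix u assume u: "u < quantile_of \<tau> F"
  show "\<forall>\<^sub>F n in sequentially. u < quantile_of \<tau> (Fn n)"
  proof (cases "u < 0")
    case True
    from n1 show ?thesis
    proof eventually_elim
      case (elim n)
      then show ?case using quantile_of_unit(1)[of \<tau> "Fn n"] Fn1[of n] \<tau> True by simp
    qed
  next
    case False
    obtain y where y: "y \<in> \<rat>" "u < y" "y < quantile_of \<tau> F" using Rats_dense_in_real[OF u] by blast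
    obtain y' where y': "y' \<in> \<rat>" "y < y'" "y' < quantile_of \<tau> F" using Rats_dense_in_real[OF y(3)] by blast
    \<comment> \<open>Below the quantile the inequality is strict, so the gap
      \<open>\<tau> - F y'\<close> absorbs the error and \<open>Fn n y\<close> stays below
      \<open>\<tau>\<close>.\<close>
    have "F y' < \<tau>" using less_of_less_quantile_of[of y' \<tau> F] y' y False Q by auto
    then have "\<forall>\<^sub>F n in sequentially. Fn n y < F y' + (\<tau> - F y')"
      using y y' False Q by (intro up) auto
    with n1 show ?thesis
    proof eventually_elim
      case (elim n)
      have "y \<le> v" if "v \<in> {0..1}" "\<tau> \<le> Fn n v" for v
        using Fn_mono[of n v y] elim that by fastforce
      then have "y \<le> quantile_of \<tau> (Fn n)"
        using Fn1[of n] elim \<tau> by (intro quantile_of_ge) auto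
      then show ?case using y by simp
    qed
  qed
next
  fix u assume u: "quantile_of \<tau> F < u"
  show "\<forall>\<^sub>F n in sequentially. quantile_of \<tau> (Fn n) < u"
  proof (cases "1 < u")
    case True
    have n1: "\<forall>\<^sub>F n in sequentially. (1::nat) \<le> n" by (rule eventually_ge_at_top)
    then show ?thesis
    proof eventually_elim
      case (elim n)
      then show ?case using quantile_of_unit(2)[of \<tau> "Fn n"] Fn1[of n] \<tau> True by simp
    qed
  next
    case False
    \<comment> \<open>Above the quantile \<open>F\<close> may equal \<open>\<tau>\<close>, leaving
      no gap for the error. A level \<open>\<tau>' > \<tau>\<close> with quantile still below
      \<open>u\<close> supplies one.\<close>
    obtain \<tau>' where \<tau>': "\<tau> < \<tau>'" "\<tau>' < 1" "quantile_of \<tau>' F < u"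
      using right_cont[of "u - quantile_of \<tau> F"] u by auto
    then obtain y0 where y0: "y0 \<in> {0..1}" "y0 < u" "\<tau>' \<le> F y0"
      using quantile_of_less_iff[of \<tau>' F u] F1 by auto
    obtain y where y: "y \<in> \<rat>" "y0 < y" "y < u" using Rats_dense_in_real[OF y0(2)] by blast
    obtain y' where y': "y' \<in> \<rat>" "y < y'" "y' < u" using Rats_dense_in_real[OF y(3)] by blast
    have "\<tau>' \<le> F y" using Fmono[of y0 y] y0 y by auto
    then have "\<forall>\<^sub>F n in sequentially. F y - (F y - \<tau>) < Fn n y'"
      using y y' y0 \<tau>' False by (intro low) auto
    then show ?thesis
    proof eventually_elim
      case (elim n)
      have "quantile_of \<tau> (Fn n) \<le> y'"
        using elim y y' y0 False by (intro quantile_of_le) auto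
      then show ?case using y' by simp
    qed
  qed
qed

section \<open>Conditional quantiles\<close>

lemma markov_kernel_cdf:
  assumes K: "markov_kernel_of \<mu> K" and x: "x \<in> {0..1}"
  shows "measure (K x) {0..1} = 1" "y \<le> y' \<Longrightarrow> measure (K x) {0..y} \<le> measure (K x) {0..y'}"
proof -
  have Kx: "prob_space (K x)" "sets (K x) = sets borel"
    using assms by (auto simp: markov_kernel_of_def)
  interpret prob_space "K x" by (rule Kx)
  show "measure (K x) {0..1} = 1" using assms by (auto simp: markov_kernel_of_def)
  show "y \<le> y' \<Longrightarrow> measure (K x) {0..y} \<le> measure (K x) {0..y'}"
    by (intro finite_measure_mono) (auto simp: Kx)
qed

lemma quantile_kernel_unit:
  assumes "markov_kernel_of \<mu> K" "x \<in> {0..1}" "\<tau> \<le> 1"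
  shows "0 \<le> quantile_kernel \<tau> K x" "quantile_kernel \<tau> K x \<le> 1"
  unfolding quantile_kernel_eq using markov_kernel_cdf(1)[OF assms(1,2)] assms(3)
  by (intro quantile_of_unit; simp)+

lemma quantile_kernel_mono:
  assumes "markov_kernel_of \<mu> K" "x \<in> {0..1}" "\<tau> \<le> \<tau>'" "\<tau>' \<le> 1"
  shows "quantile_kernel \<tau> K x \<le> quantile_kernel \<tau>' K x"
  unfolding quantile_kernel_eq using markov_kernel_cdf(1)[OF assms(1,2)] assms(3,4)
  by (intro quantile_of_mono; simp)

text \<open>Sublevel sets at \<open>u \<le> 1\<close> are countable unions over rational heights;
  higher levels give the whole space.\<close>

lemma quantile_kernel_measurable:
  assumes K: "markov_kernel_of \<mu> K" and \<tau>: "\<tau> \<le> 1"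
  shows "quantile_kernel \<tau> K \<in> borel_measurable (restrict_space lborel {0..1})"
    (is "_ \<in> borel_measurable ?R")
proof (rule borel_measurableI_less)
  fix u :: real
  have sp: "space ?R = {0..1}" by (simp add: space_restrict_space)
  have cdf: "(\<lambda>x. measure (K x) {0..y}) \<in> borel_measurable ?R" for y
    using K by (simp add: markov_kernel_of_def)
  show "{x \<in> space ?R. quantile_kernel \<tau> K x < u} \<in> sets ?R"
  proof (cases "u \<le> 1")
    case True
    have "quantile_kernel \<tau> K x < u \<longleftrightarrow> (\<exists>y\<in>{0..1} \<inter> \<rat>. y < u \<and> \<tau> \<le> measure (K x) {0..y})"
      if "x \<in> {0..1}" for x
      unfolding quantile_kernel_eq
      by (rule quantile_of_less_rat_iff) (use markov_kernel_cdf[OF K that] \<tau> True in auto)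
    then have "{x \<in> space ?R. quantile_kernel \<tau> K x < u} =
        (\<Union>y\<in>{y \<in> {0..1} \<inter> \<rat>. y < u}. {x \<in> space ?R. \<tau> \<le> measure (K x) {0..y}})"
      unfolding sp by (intro set_eqI) (auto simp only: mem_Collect_eq UN_iff Bex_def)
    also have "\<dots> \<in> sets ?R"
    proof (rule sets.countable_UN')
      show "countable {y \<in> {0..1} \<inter> \<rat>. y < u}"
        by (rule countable_subset[OF _ countable_rat]) auto
      have "{x \<in> space ?R. \<tau> \<le> measure (K x) {0..y}} \<in> sets ?R" for y
        using cdf[of y] by measurable
      then show "(\<lambda>y. {x \<in> space ?R. \<tau> \<le> measure (K x) {0..y}}) ` {y \<in> {0..1} \<inter> \<rat>. y < u} \<subseteq> sets ?R"
        by blast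
    qed
    finally show ?thesis .
  next
    case False
    then have "{x \<in> space ?R. quantile_kernel \<tau> K x < u} = space ?R"
      using quantile_kernel_unit(2)[OF K _ \<tau>] by (fastforce simp: sp)
    then show ?thesis by (simp only: sets.top)
  qed
qed

lemma integrable_quantile_kernel:
  assumes K: "markov_kernel_of \<mu> K" and \<tau>: "\<tau> \<le> 1"
  shows "set_integrable lborel {0..1} (quantile_kernel \<tau> K)"
  unfolding set_integrable_def
proof (rule Bochner_Integration.integrable_bound[where f = "indicator {0..1} :: real \<Rightarrow> real"])
  show "(\<lambda>x. indicator {0..1} x *\<^sub>R quantile_kernel \<tau> K x) \<in> borel_measurable lborel"
    using quantile_kernel_measurable[OF assms] by (simp add: borel_measurable_restrict_space_iff)
  show "AE x in lborel. norm (indicator {0..1} x *\<^sub>R quantile_kernel \<tau> K x) \<le> norm (indicator {0..1} x :: real)"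
    using quantile_kernel_unit[OF K _ \<tau>] by (intro AE_I2) (auto simp: indicator_def)
qed simp

text \<open>Averaging over \<open>x\<close> replaces uncountably many monotone functions of
  \<open>\<tau>\<close>, each with its own jumps, by a single one.\<close>

definition mean_quantile :: "(real \<Rightarrow> real measure) \<Rightarrow> real \<Rightarrow> real" where
  "mean_quantile K \<tau> = (LINT x:{0..1}|lborel. quantile_kernel \<tau> K x)"

lemma countable_mean_quantile_discontinuities:
  assumes K: "markov_kernel_of \<mu> K"
  shows "countable {\<tau> \<in> {0<..<1}. \<not> isCont (mean_quantile K) \<tau>}"
proof (rule mono_on_ctble_discont_open)
  show "mono_on {0<..<1} (mean_quantile K)"
    unfolding mean_quantile_def
    by (intro mono_onI set_integral_mono integrable_quantile_kernel[OF K] quantile_kernel_mono[OF K]) auto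
qed simp

text \<open>A jump at \<open>\<tau>\<close> of the quantile function on a set of positive measure is a jump of its mean, and
  a monotone function has only countably many jumps; this is where the exceptional set comes from.\<close>

lemma AE_quantile_kernel_right_continuous:
  assumes K: "markov_kernel_of \<mu> K" and \<tau>: "\<tau> \<in> {0<..<1}" and cont: "isCont (mean_quantile K) \<tau>"
  shows "AE x in lborel. x \<in> {0..1} \<longrightarrow>
    (\<forall>e>0. \<exists>\<tau>'>\<tau>. \<tau>' < 1 \<and> quantile_kernel \<tau>' K x < quantile_kernel \<tau> K x + e)"
proof -
  \<comment> \<open>Levels decreasing to \<open>\<tau>\<close>; the summand 2 keeps even
    \<open>t 0\<close> below 1.\<close>
  define t where "t m = \<tau> + (1 - \<tau>) / (real m + 2)" for m :: nat
  have t: "\<tau> < t m" "t m < 1" for m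
  proof -
    show "\<tau> < t m" using \<tau> by (simp add: t_def)
    have "(1 - \<tau>) / (real m + 2) < 1 - \<tau>" using \<tau> by (simp add: pos_divide_less_eq)
    then show "t m < 1" by (simp add: t_def)
  qed
  have "t \<longlonglongrightarrow> \<tau>" unfolding t_def by real_asymp
  with cont have lim: "(\<lambda>m. mean_quantile K (t m)) \<longlonglongrightarrow> mean_quantile K \<tau>"
    by (rule isCont_tendsto_compose)
  define h where "h m x = indicator {0..1} x * (quantile_kernel (t m) K x - quantile_kernel \<tau> K x)" for m x
  have int: "integrable lborel (\<lambda>x. indicator {0..1} x * quantile_kernel \<sigma> K x)" if "\<sigma> \<le> 1" for \<sigma>
    using integrable_quantile_kernel[OF K that] by (simp add: set_integrable_def)
  have h_int: "integrable lborel (h m)" for m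
    unfolding h_def right_diff_distrib using t(2)[of m] \<tau>
    by (intro Bochner_Integration.integrable_diff int) auto
  have h_eq: "integral\<^sup>L lborel (h m) = mean_quantile K (t m) - mean_quantile K \<tau>" for m
    unfolding h_def right_diff_distrib using t(2)[of m] \<tau>
    by (subst Bochner_Integration.integral_diff) (auto intro!: int simp: mean_quantile_def set_lebesgue_integral_def)
  have h_nonneg: "0 \<le> h m x" for m x
    unfolding h_def using quantile_kernel_mono[OF K, of x \<tau> "t m"] t[of m] by (auto simp: indicator_def)
  \<comment> \<open>On the unit interval this is the right-hand jump of the quantile function at
    \<open>\<tau>\<close>. Its integral is below every difference of means, and these tend to
    0.\<close>
  define g where "g x = (INF m. h m x)" for x
  have bdd: "bdd_below (range (\<lambda>m. h m x))" for x
    by (rule bdd_belowI[of _ 0]) (use h_nonneg in auto)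
  have g_le: "g x \<le> h m x" for x m
    unfolding g_def by (rule cINF_lower[OF bdd]) simp
  have g_nonneg: "0 \<le> g x" for x
    unfolding g_def by (rule cINF_greatest) (use h_nonneg in auto)
  have g_meas: "g \<in> borel_measurable lborel"
    unfolding g_def by (rule borel_measurable_cINF_real) (use h_int in auto)
  have g_int: "integrable lborel g"
    by (rule Bochner_Integration.integrable_bound[OF h_int[of 0] g_meas])
      (use g_le[of _ 0] g_nonneg h_nonneg in \<open>auto intro!: AE_I2\<close>)
  have "integral\<^sup>L lborel g \<le> mean_quantile K (t m) - mean_quantile K \<tau>" for m
    unfolding h_eq[symmetric] by (intro integral_mono g_int h_int g_le)
  moreover have "(\<lambda>m. mean_quantile K (t m) - mean_quantile K \<tau>) \<longlonglongrightarrow> mean_quantile K \<tau> - mean_quantile K \<tau>"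
    by (intro tendsto_diff lim tendsto_const)
  ultimately have "integral\<^sup>L lborel g \<le> 0"
    by (intro LIMSEQ_le_const) auto
  moreover have "0 \<le> integral\<^sup>L lborel g" using g_nonneg by (intro integral_nonneg_AE) auto
  ultimately have "AE x in lborel. g x = 0"
    using integral_nonneg_eq_0_iff_AE[OF g_int] g_nonneg by auto
  then show ?thesis
  proof eventually_elim
    case (elim x)
    show ?case
    proof (intro impI allI)
      fix e :: real assume x: "x \<in> {0..1}" and "0 < e"
      then have "(INF m. h m x) < e" using elim by (simp add: g_def)
      then obtain m where "h m x < e" using cINF_less_iff[OF _ bdd, of x e] by auto
      then show "\<exists>\<tau>'>\<tau>. \<tau>' < 1 \<and> quantile_kernel \<tau>' K x < quantile_kernel \<tau> K x + e"
        using t[of m] x by (intro exI[of _ "t m"]) (auto simp: h_def)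
    qed
  qed
qed

text \<open>Telescoping in \<open>j\<close> leaves four corners; those at height 0 remain because
  \<open>D\<close> is arbitrary.\<close>

lemma sum_cb_mass:
  "(\<Sum>j\<in>{1..J}. cb_mass N D i j) =
     D (real i / real N) (real J / real N) - D ((real i - 1) / real N) (real J / real N)
     - D (real i / real N) 0 + D ((real i - 1) / real N) 0"
  by (induction J) (auto simp: cb_mass_def)

section \<open>Independence of the kernel version and convergence of checkerboard quantiles\<close>

context copula_measure
begin

text \<open>At rational heights both conditional cdfs are the derivative of the same function, and
  rational heights determine the quantiles.\<close>

lemma AE_quantile_kernel_unique:
  assumes K: "markov_kernel_of \<mu> K" and K': "markov_kernel_of \<mu> K'"
  shows "AE x in lborel. x \<in> {0..1} \<longrightarrow> (\<forall>\<tau>\<le>1. quantile_kernel \<tau> K x = quantile_kernel \<tau> K' x)"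
  using AE_joint_cdf_derivative[OF K] AE_joint_cdf_derivative[OF K']
proof eventually_elim
  case (elim x)
  show ?case
  proof (intro impI allI)
    fix \<tau> :: real assume x: "x \<in> {0..1}" and \<tau>: "\<tau> \<le> 1"
    have eq: "measure (K x) {0..y} = measure (K' x) {0..y}" if "y \<in> \<rat>" for y
      using elim x that DERIV_unique by blast
    show "quantile_kernel \<tau> K x = quantile_kernel \<tau> K' x"
      unfolding quantile_kernel_eq
      by (rule quantile_of_cong_rat) (use markov_kernel_cdf[OF K x] markov_kernel_cdf[OF K' x] eq \<tau> in auto)
  qed
qed

text \<open>Allows an exceptional set built from one kernel to serve all of them.\<close>

lemma mean_quantile_unique:
  assumes K: "markov_kernel_of \<mu> K" and K': "markov_kernel_of \<mu> K'" and "\<tau> \<le> 1"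
  shows "mean_quantile K \<tau> = mean_quantile K' \<tau>"
  unfolding mean_quantile_def set_lebesgue_integral_def
proof (rule integral_cong_AE)
  show "AE x in lborel. indicator {0..1} x *\<^sub>R quantile_kernel \<tau> K x = indicator {0..1} x *\<^sub>R quantile_kernel \<tau> K' x"
    using AE_quantile_kernel_unique[OF K K'] by eventually_elim (use assms(3) in \<open>auto simp: indicator_def\<close>)
qed (use integrable_quantile_kernel[OF K assms(3)] integrable_quantile_kernel[OF K' assms(3)]
      in \<open>auto simp: set_integrable_def\<close>)

text \<open>The 2-increasing property: each increment is the mass of a strip that grows with its
  height.\<close>

lemma joint_cdf_increment_mono:
  assumes "a \<le> b" "y \<le> y'"
  shows "joint_cdf \<mu> b y - joint_cdf \<mu> a y \<le> joint_cdf \<mu> b y' - joint_cdf \<mu> a y'"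
proof -
  have incr: "joint_cdf \<mu> b v - joint_cdf \<mu> a v = measure \<mu> ({a<..b} \<times> {..v})" for v
  proof -
    have eq: "{a<..b} \<times> {..v} = {..b} \<times> {..v} - {..a} \<times> {..v}" by auto
    show ?thesis
      unfolding joint_cdf_def using assms(1)
      by (subst eq, subst finite_measure_Diff) (auto intro: Times_borel_real)
  qed
  show ?thesis
    unfolding incr using assms(2) by (intro finite_measure_mono) (auto intro: Times_borel_real)
qed

text \<open>A grid point fits between \<open>y\<close> and \<open>y'\<close>, and everything is
  monotone in the height. The constant 4 counts the corners in \<open>sum_cb_mass\<close>, each
  replaced at cost \<open>d\<close>.\<close>

lemma checkerboard_cdf_sandwich:
  assumes "0 < N" and i: "i \<in> {1..N}" and K: "markov_kernel_of \<nu> K" and x: "x \<in> {0..1}"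
    and cell: "\<And>J. J \<le> N \<Longrightarrow> measure (K x) {0..real J / real N} = real N * (\<Sum>j\<in>{1..J}. cb_mass N D i j)"
    and close: "\<And>u v. u \<in> {0..1} \<Longrightarrow> v \<in> {0..1} \<Longrightarrow> \<bar>D u v - joint_cdf \<mu> u v\<bar> \<le> d"
    and y: "0 \<le> y" "y' \<le> 1" "1 / real N < y' - y"
  shows "measure (K x) {0..y} \<le>
      real N * (joint_cdf \<mu> (real i / real N) y' - joint_cdf \<mu> ((real i - 1) / real N) y') + 4 * (real N * d)"
    and "real N * (joint_cdf \<mu> (real i / real N) y - joint_cdf \<mu> ((real i - 1) / real N) y) - 4 * (real N * d)
      \<le> measure (K x) {0..y'}"
proof -
  let ?a = "(real i - 1) / real N" and ?b = "real i / real N"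
  have ab: "?a \<in> {0..1}" "?b \<in> {0..1}" "?a \<le> ?b"
    using i \<open>0 < N\<close> by (auto simp: divide_simps)
  define J where "J = nat \<lceil>real N * y\<rceil>"
  have "0 \<le> real N * y" using y by simp
  then have rJ: "real J = of_int \<lceil>real N * y\<rceil>" unfolding J_def by simp
  have "real N * y \<le> real J" "real J \<le> real N * y + 1" unfolding rJ by linarith+
  then have J: "y \<le> real J / real N" "real J / real N \<le> y'"
    using \<open>0 < N\<close> y(3) by (auto simp: field_simps)
  have "real J / real N \<le> 1" using J(2) y(2) by linarith
  then have "J \<le> N" using \<open>0 < N\<close> by (simp add: pos_divide_le_eq)
  let ?J = "real J / real N"
  define \<Delta> where "\<Delta> v = joint_cdf \<mu> ?b v - joint_cdf \<mu> ?a v" for v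
  have "?J \<in> {0..1}" using J y by auto
  \<comment> \<open>The joint cdf vanishes at height 0, so the two bottom corners of
    \<open>D\<close> are pure error.\<close>
  have "\<bar>(\<Sum>j\<in>{1..J}. cb_mass N D i j) - \<Delta> ?J\<bar> \<le> 4 * d"
    unfolding sum_cb_mass \<Delta>_def
    using close[OF ab(1) \<open>?J \<in> {0..1}\<close>] close[OF ab(2) \<open>?J \<in> {0..1}\<close>] close[OF ab(1), of 0] close[OF ab(2), of 0]
      joint_cdf_zero[of ?a 0] joint_cdf_zero[of ?b 0]
    by simp
  then have "\<bar>real N * (\<Sum>j\<in>{1..J}. cb_mass N D i j) - real N * \<Delta> ?J\<bar> \<le> real N * (4 * d)"
    unfolding right_diff_distrib[symmetric] abs_mult using \<open>0 < N\<close> by simp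
  then have FJ: "\<bar>measure (K x) {0..?J} - real N * \<Delta> ?J\<bar> \<le> 4 * (real N * d)"
    unfolding cell[OF \<open>J \<le> N\<close>] by simp
  have "real N * \<Delta> y \<le> real N * \<Delta> ?J" "real N * \<Delta> ?J \<le> real N * \<Delta> y'"
    unfolding \<Delta>_def by (intro mult_left_mono joint_cdf_increment_mono ab J; simp)+
  moreover have "measure (K x) {0..y} \<le> measure (K x) {0..?J}" "measure (K x) {0..?J} \<le> measure (K x) {0..y'}"
    by (intro markov_kernel_cdf(2)[OF K x] J)+
  ultimately show "measure (K x) {0..y} \<le> real N * (joint_cdf \<mu> ?b y' - joint_cdf \<mu> ?a y') + 4 * (real N * d)"
    "real N * (joint_cdf \<mu> ?b y - joint_cdf \<mu> ?a y) - 4 * (real N * d) \<le> measure (K x) {0..y'}"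
    using FJ unfolding \<Delta>_def[symmetric] by linarith+
qed

text \<open>The deterministic core: only the uniform error \<open>d n\<close>, negligible against
  \<open>1 / N n\<close>, remains of the sampling. The sandwich bounds converge to the conditional
  cdf at rational heights.\<close>

lemma AE_quantile_checkerboard_tendsto:
  fixes N :: "nat \<Rightarrow> nat" and D :: "nat \<Rightarrow> real \<Rightarrow> real \<Rightarrow> real"
  assumes K: "markov_kernel_of \<mu> K"
    and Kn: "\<And>n. 1 \<le> n \<Longrightarrow> markov_kernel_of (checkerboard (N n) (D n)) (Kn n)"
    and N: "\<And>n. 1 \<le> n \<Longrightarrow> 1 \<le> N n" "filterlim N at_top sequentially"
    and nonneg: "\<And>n i j. 1 \<le> n \<Longrightarrow> i \<in> {1..N n} \<Longrightarrow> j \<in> {1..N n} \<Longrightarrow> 0 \<le> cb_mass (N n) (D n) i j"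
    and close: "\<forall>\<^sub>F n in sequentially. \<forall>u\<in>{0..1}. \<forall>v\<in>{0..1}. \<bar>D n u v - joint_cdf \<mu> u v\<bar> \<le> d n"
    and d: "(\<lambda>n. real (N n) * d n) \<longlonglongrightarrow> 0"
    and \<tau>: "\<tau> \<in> {0<..<1}" and cont: "isCont (mean_quantile K) \<tau>"
  shows "AE x in lborel. x \<in> {0..1} \<longrightarrow> (\<lambda>n. quantile_kernel \<tau> (Kn n) x) \<longlonglongrightarrow> quantile_kernel \<tau> K x"
proof -
  \<comment> \<open>The guards on \<open>n\<close> and \<open>J\<close> stand inside, so that the
    null sets of all pairs can be united.\<close>
  have "AE x in lborel. 1 \<le> n \<longrightarrow> J \<le> N n \<longrightarrow> (\<forall>i\<in>{1..N n}. x \<in> cb_cell (N n) i \<longrightarrow>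
      measure (Kn n x) {0..real J / real (N n)} = real (N n) * (\<Sum>j\<in>{1..J}. cb_mass (N n) (D n) i j))" for n J
    using AE_checkerboard_kernel[OF nonneg Kn, of n J] N(1)[of n] by (cases "1 \<le> n \<and> J \<le> N n") auto
  then have cells: "AE x in lborel. \<forall>n J. 1 \<le> n \<longrightarrow> J \<le> N n \<longrightarrow> (\<forall>i\<in>{1..N n}. x \<in> cb_cell (N n) i \<longrightarrow>
      measure (Kn n x) {0..real J / real (N n)} = real (N n) * (\<Sum>j\<in>{1..J}. cb_mass (N n) (D n) i j))"
    unfolding AE_all_countable by blast
  \<comment> \<open>Cell boundaries are rational, so an irrational point lies in an open cell for
    every \<open>n\<close>.\<close>
  have irrat: "AE x in lborel. (x::real) \<notin> \<rat>"
    by (intro AE_not_in countable_imp_null_set_lborel countable_rat)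
  show ?thesis
    using cells irrat AE_joint_cdf_derivative[OF K] AE_quantile_kernel_right_continuous[OF K \<tau> cont]
  proof eventually_elim
    case (elim x)
    show ?case
    proof
      assume x: "x \<in> {0..1}"
      then have x01: "0 < x" "x < 1" using elim(2) by (auto simp: less_le)
      define i where "i n = nat \<lceil>real (N n) * x\<rceil>" for n
      define a where "a n = (real (i n) - 1) / real (N n)" for n
      define b where "b n = real (i n) / real (N n)" for n
      have cell: "i n \<in> {1..N n} \<and> x \<in> cb_cell (N n) (i n)" if n: "1 \<le> n" for n
      proof -
        have Npos: "0 < real (N n)" using N(1)[OF n] by simp
        have pos: "0 < real (N n) * x" using Npos x01 by simp
        then have ri: "real (i n) = of_int \<lceil>real (N n) * x\<rceil>" unfolding i_def by simp
        have ne: "real (i n) \<noteq> real (N n) * x"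
        proof
          assume "real (i n) = real (N n) * x"
          then have "x = real (i n) / real (N n)" using Npos by simp
          then show False using elim(2) by (simp add: Rats_divide)
        qed
        have "real (i n) - 1 < real (N n) * x" "real (N n) * x \<le> real (i n)"
          unfolding ri by linarith+
        with ne have "real (i n) - 1 < real (N n) * x" "real (N n) * x < real (i n)" by auto
        moreover have "real (N n) * x < real (N n)" using Npos x01 by simp
        ultimately have "real (i n) - 1 < real (N n) * x" "real (N n) * x < real (i n)" "i n \<le> N n" "1 \<le> i n"
          using pos by linarith+
        then show ?thesis
          using Npos by (auto simp: cb_cell_def field_simps)
      qed
      let ?F = "\<lambda>y. measure (K x) {0..y}" and ?Fn = "\<lambda>n y. measure (Kn n x) {0..y}"
      let ?avg = "\<lambda>n y. real (N n) * (joint_cdf \<mu> (b n) y - joint_cdf \<mu> (a n) y)"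
      have Ninv: "(\<lambda>n. 1 / real (N n)) \<longlonglongrightarrow> 0"
        using filterlim_compose[OF lim_inverse_n' N(2)] .
      have ba: "b n - a n = 1 / real (N n)" for n
        by (simp add: a_def b_def diff_divide_distrib)
      have ev1: "\<forall>\<^sub>F n in sequentially. (1::nat) \<le> n" by (rule eventually_ge_at_top)
      \<comment> \<open>Since the cell has length \<open>1 / N n\<close>, \<open>?avg\<close> is the
        difference quotient over it.\<close>
      have avg: "(\<lambda>n. ?avg n y) \<longlonglongrightarrow> ?F y" if "y \<in> \<rat>" for y
      proof -
        have "(\<lambda>n. (joint_cdf \<mu> (b n) y - joint_cdf \<mu> (a n) y) / (b n - a n)) \<longlonglongrightarrow> ?F y"
        proof (rule straddle_quotient_tendsto)
          show "((\<lambda>u. joint_cdf \<mu> u y) has_real_derivative ?F y) (at x)"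
            using elim(3) x that by blast
          show "\<forall>\<^sub>F n in sequentially. a n \<le> x \<and> x \<le> b n \<and> a n < b n"
            using ev1 by eventually_elim (use cell in \<open>fastforce simp: cb_cell_def a_def b_def\<close>)
          show "(\<lambda>n. b n - a n) \<longlonglongrightarrow> 0" unfolding ba by (rule Ninv)
        qed
        then show ?thesis unfolding ba by (simp add: mult.commute)
      qed
      have sandwich: "\<forall>\<^sub>F n in sequentially.
          ?Fn n y \<le> ?avg n y' + 4 * (real (N n) * d n) \<and> ?avg n y - 4 * (real (N n) * d n) \<le> ?Fn n y'"
        if y: "0 \<le> y" "y < y'" "y' \<le> 1" for y y'
      proof -
        have "\<forall>\<^sub>F n in sequentially. 1 / real (N n) < y' - y"
          using y by (intro order_tendstoD(2)[OF Ninv]) simp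
        with ev1 close show ?thesis
        proof eventually_elim
          case (elim n)
          have Npos: "0 < N n" using N(1)[of n] elim by simp
          show ?case
            unfolding a_def b_def
            using checkerboard_cdf_sandwich[OF Npos _ Kn x, of "i n" n "D n" "d n" y y']
              cell[of n] elim y \<open>\<forall>n J. 1 \<le> n \<longrightarrow> J \<le> N n \<longrightarrow> _\<close>
            by auto
        qed
      qed
      have d4: "(\<lambda>n. 4 * (real (N n) * d n)) \<longlonglongrightarrow> 4 * 0" by (intro tendsto_mult_left d)
      show "(\<lambda>n. quantile_kernel \<tau> (Kn n) x) \<longlonglongrightarrow> quantile_kernel \<tau> K x"
        unfolding quantile_kernel_eq
      proof (rule quantile_of_tendsto)
        fix y y' e :: real
        assume y: "y \<in> \<rat>" "y' \<in> \<rat>" "0 \<le> y" "y < y'" "y' \<le> 1" and e: "0 < e"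
        have "(\<lambda>n. ?avg n y - 4 * (real (N n) * d n)) \<longlonglongrightarrow> ?F y - 4 * 0"
          by (intro tendsto_diff avg y d4)
        then have "\<forall>\<^sub>F n in sequentially. ?F y - e < ?avg n y - 4 * (real (N n) * d n)"
          using e by (intro order_tendstoD(1)) auto
        with sandwich[OF y(3-5)] show "\<forall>\<^sub>F n in sequentially. ?F y - e < ?Fn n y'"
          by eventually_elim linarith
        have "(\<lambda>n. ?avg n y' + 4 * (real (N n) * d n)) \<longlonglongrightarrow> ?F y' + 4 * 0"
          by (intro tendsto_add avg y d4)
        then have "\<forall>\<^sub>F n in sequentially. ?avg n y' + 4 * (real (N n) * d n) < ?F y' + e"
          using e by (intro order_tendstoD(2)) auto
        with sandwich[OF y(3-5)] show "\<forall>\<^sub>F n in sequentially. ?Fn n y < ?F y' + e"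
          by eventually_elim linarith
      next
        fix e :: real assume "0 < e"
        then show "\<exists>\<tau>'>\<tau>. \<tau>' < 1 \<and> quantile_of \<tau>' ?F < quantile_of \<tau> ?F + e"
          using elim(4) x unfolding quantile_kernel_eq by blast
      qed (use markov_kernel_cdf[OF K x] markov_kernel_cdf[OF Kn x] \<tau> in auto)
    qed
  qed
qed

end

section \<open>From almost everywhere convergence to convergence in Lp\<close>

lemma Lp_tendsto_of_AE_tendsto_unit:
  fixes f :: "real \<Rightarrow> real" and fn :: "nat \<Rightarrow> real \<Rightarrow> real"
  assumes f: "f \<in> borel_measurable (restrict_space lborel {0..1})" "\<And>x. x \<in> {0..1} \<Longrightarrow> f x \<in> {0..1}"
    and fn: "\<And>n. 1 \<le> n \<Longrightarrow> fn n \<in> borel_measurable (restrict_space lborel {0..1})"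
      "\<And>n x. 1 \<le> n \<Longrightarrow> x \<in> {0..1} \<Longrightarrow> fn n x \<in> {0..1}"
    and lim: "AE x in lborel. x \<in> {0..1} \<longrightarrow> (\<lambda>n. fn n x) \<longlonglongrightarrow> f x"
    and p: "1 \<le> p"
  shows "(\<lambda>n. (LINT x:{0..1}|lborel. \<bar>fn n x - f x\<bar> powr p) powr (1 / p)) \<longlonglongrightarrow> 0"
proof (rule tendsto_zero_powrI)
  let ?g = "\<lambda>n x. indicator {0..1} x *\<^sub>R (\<bar>fn n x - f x\<bar> powr p)"
  \<comment> \<open>Values in the unit interval make the indicator a dominating function. The shift
    by \<open>Suc\<close> skips index 0, where nothing is known about \<open>fn\<close>.\<close>
  have "(\<lambda>n. LINT x|lborel. ?g (Suc n) x) \<longlonglongrightarrow> (LINT x|(lborel :: real measure). (0::real))"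
  proof (rule integral_dominated_convergence[where w = "indicator {0..1}"])
    show "integrable lborel (indicator {0..1} :: real \<Rightarrow> real)" by simp
    show "?g (Suc n) \<in> borel_measurable lborel" for n
    proof -
      have [measurable]: "fn (Suc n) \<in> borel_measurable (restrict_space lborel {0..1})" by (rule fn) simp
      note [measurable] = f(1)
      have "(\<lambda>x. \<bar>fn (Suc n) x - f x\<bar> powr p) \<in> borel_measurable (restrict_space lborel {0..1})"
        by measurable
      then show ?thesis by (subst (asm) borel_measurable_restrict_space_iff) auto
    qed
    show "AE x in lborel. norm (?g (Suc n) x) \<le> indicator {0..1} x" for n
    proof (intro AE_I2)
      fix x :: real
      have "\<bar>fn (Suc n) x - f x\<bar> powr p \<le> 1" if "x \<in> {0..1}"
        using f(2)[OF that] fn(2)[of "Suc n" x] that p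
        by (intro powr_le1) (auto simp: abs_le_iff)
      then show "norm (?g (Suc n) x) \<le> indicator {0..1} x" by (auto simp: indicator_def)
    qed
    show "AE x in lborel. (\<lambda>n. ?g (Suc n) x) \<longlonglongrightarrow> 0"
      using lim
    proof eventually_elim
      case (elim x)
      show ?case
      proof (cases "x \<in> {0..1}")
        case True
        then have "(\<lambda>n. fn (Suc n) x) \<longlonglongrightarrow> f x" using elim LIMSEQ_Suc by blast
        then have "(\<lambda>n. \<bar>fn (Suc n) x - f x\<bar>) \<longlonglongrightarrow> 0"
          using tendsto_rabs_zero LIM_zero by blast
        then have "(\<lambda>n. \<bar>fn (Suc n) x - f x\<bar> powr p) \<longlonglongrightarrow> 0"
          using p by (intro tendsto_zero_powrI[where b = p]) auto
        then show ?thesis using True by simp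
      qed simp
    qed
  qed simp
  then have "(\<lambda>n. LINT x:{0..1}|lborel. \<bar>fn (Suc n) x - f x\<bar> powr p) \<longlonglongrightarrow> 0"
    by (simp add: set_lebesgue_integral_def)
  then show "(\<lambda>n. LINT x:{0..1}|lborel. \<bar>fn n x - f x\<bar> powr p) \<longlonglongrightarrow> 0"
    by (rule LIMSEQ_imp_Suc)
  show "\<forall>\<^sub>F n in sequentially. 0 \<le> (LINT x:{0..1}|lborel. \<bar>fn n x - f x\<bar> powr p)"
    unfolding set_lebesgue_integral_def by (intro always_eventually allI integral_nonneg_AE AE_I2) auto
  show "(\<lambda>n. 1 / p) \<longlonglongrightarrow> 1 / p" by simp
  show "0 < 1 / p" using p by simp
qed

text \<open>Kernels are determined only up to null sets, so every version is covered:
  \<open>T\<close> is chosen before \<open>K\<close>, and for fixed \<open>\<tau>\<close> and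
  \<open>K\<close> one event of probability one serves all \<open>Kn\<close> and all
  \<open>p\<close>.\<close>

theorem theorem25:
  fixes M :: "'a measure" and \<mu> :: "(real \<times> real) measure"
    and X :: "nat \<Rightarrow> 'a \<Rightarrow> real \<times> real" and s :: real
  assumes "prob_space M"
    and "is_copula_measure \<mu>"
    and "prob_space.indep_vars M (\<lambda>_. borel) X UNIV"
    and "\<And>i. distr M borel (X i) = \<mu>"
    and "0 < s" and "s < 1 / 2"
  shows "\<exists>T. countable T \<and> T \<subseteq> {0<..<1} \<and>
    (\<forall>\<tau>\<in>{0<..<1} - T. \<forall>K. markov_kernel_of \<mu> K \<longrightarrow>
      (AE \<omega> in M. \<forall>Kn :: nat \<Rightarrow> real \<Rightarrow> real measure.
         (\<forall>n\<ge>1. markov_kernel_of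
                    (checkerboard (nat \<lfloor>real n powr s\<rfloor>) (emp_copula n (\<lambda>k. X k \<omega>))) (Kn n))
         \<longrightarrow> (AE x in lborel. x \<in> {0..1} \<longrightarrow>
                (\<lambda>n. quantile_kernel \<tau> (Kn n) x) \<longlonglongrightarrow> quantile_kernel \<tau> K x)
           \<and> (\<forall>p::real. 1 \<le> p \<longrightarrow>
                (\<lambda>n. (LINT x:{0..1}|lborel.
                        \<bar>quantile_kernel \<tau> (Kn n) x - quantile_kernel \<tau> K x\<bar> powr p) powr (1 / p))
                \<longlonglongrightarrow> 0)))"
\<comment> \<open>With no kernel the claim is vacuous; otherwise a fixed version \<open>K0\<close>
  defines \<open>T\<close>.\<close>
proof (cases "\<exists>K0. markov_kernel_of \<mu> K0")
  case False
  then show ?thesis by (intro exI[of _ "{}"]) auto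
next
  case True
  then obtain K0 where K0: "markov_kernel_of \<mu> K0" by blast
  interpret copula_measure \<mu> by standard (rule assms(2))
  interpret P: prob_space M by (rule assms(1))
  define T where "T = {\<tau> \<in> {0<..<1}. \<not> isCont (mean_quantile K0) \<tau>}"
  define N where "N n = nat \<lfloor>real n powr s\<rfloor>" for n
  have N1: "1 \<le> N n" if "1 \<le> n" for n
  proof -
    have "1 \<le> real n powr s" using that assms(5) by (simp add: ge_one_powr_ge_zero)
    then show ?thesis unfolding N_def by (simp add: le_nat_floor le_floor_iff)
  qed
  have N_le: "real (N n) \<le> real n powr s" for n
    unfolding N_def by simp
  have N_top: "filterlim N at_top sequentially"
    unfolding N_def
    by (intro filterlim_compose[OF filterlim_nat_sequentially] filterlim_compose[OF filterlim_floor_sequentially]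
        real_powr_at_top filterlim_compose[OF real_powr_at_top filterlim_real_sequentially] assms)
  show ?thesis
  proof (intro exI[of _ T] conjI ballI allI impI)
    show "countable T" unfolding T_def by (rule countable_mean_quantile_discontinuities[OF K0])
    show "T \<subseteq> {0<..<1}" by (auto simp: T_def)
    fix \<tau> K assume \<tau>: "\<tau> \<in> {0<..<1} - T" and K: "markov_kernel_of \<mu> K"
    have "isCont (mean_quantile K0) \<tau>" using \<tau> by (simp add: T_def)
    \<comment> \<open>Continuity at \<open>\<tau>\<close> needs equality of the two means on a
      neighbourhood, and the open interval of admissible levels is one.\<close>
    moreover have "\<forall>\<^sub>F \<sigma> in nhds \<tau>. mean_quantile K0 \<sigma> = mean_quantile K \<sigma>"
      using \<tau> by (intro eventually_mono[OF eventually_nhds_in_open[of "{0<..<1}"]])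
        (auto intro!: mean_quantile_unique[OF K0 K])
    ultimately have cont: "isCont (mean_quantile K) \<tau>" by (simp add: isCont_cong)
    show "AE \<omega> in M. \<forall>Kn :: nat \<Rightarrow> real \<Rightarrow> real measure.
         (\<forall>n\<ge>1. markov_kernel_of
                    (checkerboard (nat \<lfloor>real n powr s\<rfloor>) (emp_copula n (\<lambda>k. X k \<omega>))) (Kn n))
         \<longrightarrow> (AE x in lborel. x \<in> {0..1} \<longrightarrow>
                (\<lambda>n. quantile_kernel \<tau> (Kn n) x) \<longlonglongrightarrow> quantile_kernel \<tau> K x)
           \<and> (\<forall>p::real. 1 \<le> p \<longrightarrow>
                (\<lambda>n. (LINT x:{0..1}|lborel.
                        \<bar>quantile_kernel \<tau> (Kn n) x - quantile_kernel \<tau> K x\<bar> powr p) powr (1 / p))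
                \<longlonglongrightarrow> 0)"
      using P.emp_copula_rate[OF assms(2,3,4,6)]
    proof eventually_elim
      case (elim \<omega>)
      let ?E = "\<lambda>n. emp_copula n (\<lambda>k. X k \<omega>)"
      obtain d where d: "(\<lambda>n. real n powr s * d n) \<longlonglongrightarrow> 0"
        and close: "\<forall>\<^sub>F n in sequentially. \<forall>x\<in>{0..1}. \<forall>y\<in>{0..1}. \<bar>?E n x y - joint_cdf \<mu> x y\<bar> \<le> d n"
        using elim by blast
      have Nd: "(\<lambda>n. real (N n) * d n) \<longlonglongrightarrow> 0"
      proof (rule Lim_null_comparison[OF _ d])
        from close show "\<forall>\<^sub>F n in sequentially. norm (real (N n) * d n) \<le> real n powr s * d n"
        proof eventually_elim
          case (elim n)
          \<comment> \<open>Any point of the square shows that \<open>d n\<close> is nonnegative, so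
            \<open>N n\<close> may be replaced by the larger \<open>n powr s\<close>.\<close>
          then have "\<bar>?E n 0 0 - joint_cdf \<mu> 0 0\<bar> \<le> d n" by auto
          then have "0 \<le> d n" by linarith
          then show ?case using N_le[of n] by (simp add: mult_right_mono)
        qed
      qed
      show ?case
        unfolding N_def[symmetric]
      proof (intro allI impI conjI)
        fix Kn :: "nat \<Rightarrow> real \<Rightarrow> real measure"
        assume "\<forall>n\<ge>1. markov_kernel_of (checkerboard (N n) (?E n)) (Kn n)"
        then have Kn: "markov_kernel_of (checkerboard (N n) (?E n)) (Kn n)" if "1 \<le> n" for n
          using that by blast
        show lim: "AE x in lborel. x \<in> {0..1} \<longrightarrow>
            (\<lambda>n. quantile_kernel \<tau> (Kn n) x) \<longlonglongrightarrow> quantile_kernel \<tau> K x"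
          by (rule AE_quantile_checkerboard_tendsto[OF K Kn N1 N_top _ close Nd _ cont])
            (use \<tau> in \<open>auto intro!: cb_mass_emp_copula_nonneg\<close>)
        have "\<tau> \<le> 1" using \<tau> by simp
        show "(\<lambda>n. (LINT x:{0..1}|lborel. \<bar>quantile_kernel \<tau> (Kn n) x - quantile_kernel \<tau> K x\<bar> powr p) powr (1 / p))
            \<longlonglongrightarrow> 0" if "1 \<le> p" for p
          by (rule Lp_tendsto_of_AE_tendsto_unit[OF _ _ _ _ lim that])
            (use quantile_kernel_measurable[OF K \<open>\<tau> \<le> 1\<close>] quantile_kernel_unit[OF K _ \<open>\<tau> \<le> 1\<close>]
              quantile_kernel_measurable[OF Kn \<open>\<tau> \<le> 1\<close>] quantile_kernel_unit[OF Kn _ \<open>\<tau> \<le> 1\<close>] in auto)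
      qed
    qed
  qed
qed

end
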